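(* Let $k \leq n$ be positive integers. The set $\mathcal{GS}_{n,k}$ of $(n,k)$-Garsia–Stanton monomials descends to a vector space basis of $R_{n,k}$.
   Context: For positive integers $k \le n$, $I_{n,k} \subseteq \mathbb{Q}[x_1,\dots,x_n]$ is the ideal $\langle x_1^k, \dots, x_n^k, e_n, e_{n-1}, \dots, e_{n-k+1}\rangle$, where $e_d = e_d(x_1,\dots,x_n)$ is the elementary symmetric polynomial of degree $d$, and $R_{n,k} := \mathbb{Q}[x_1,\dots,x_n]/I_{n,k}$. For a permutation $\pi = \pi_1\cdots\pi_n \in \mathfrak{S}_n$, $\mathrm{Des}(\pi) = \{1\le i\le n-1 : \pi_i>\pi_{i+1}\}$, $\mathrm{des}(\pi) = |\mathrm{Des}(\pi)|$, and the Garsia–Stanton monomial is $gs_\pi := \prod_{i \in \mathrm{Des}(\pi)} x_{\pi_1}x_{\pi_2}\cdots x_{\pi_i}$. The $(n,k)$-Garsia–Stanton monomials are $$\mathcal{GS}_{n,k} := \{ gs_\pi \cdot x_{\pi_1}^{i_1}x_{\pi_2}^{i_2}\cdots x_{\pi_{n-k}}^{i_{n-k}} : \pi \in \mathfrak{S}_n,\ \mathrm{des}(\pi)<k,\ (k-\mathrm{des}(\pi)) > i_1 \ge i_2 \ge \cdots \ge i_{n-k} \ge 0\}.$$ *)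

theory Defs
  imports
    "HOL-Library.Poly_Mapping"
    "HOL-Combinatorics.Permutations"
    "HOL-Algebra.QuotRing"
    "HOL-Algebra.Subrings"
    "Jordan_Normal_Form.VS_Connect"
begin

text \<open>
  A polynomial is a finitely supported map from exponent vectors to rational coefficients;
  \<open>Poly_Mapping\<close> makes this type a commutative ring, with polynomial multiplication as product.
  It has infinitely many variables, so the ring in the variables \<open>x\<^sub>1, \<dots>, x\<^sub>n\<close> is the subring
  of those polynomials in which only variables with index in \<open>{1..n}\<close> occur.
\<close>

type_synonym rpoly = "(nat \<Rightarrow>\<^sub>0 nat) \<Rightarrow>\<^sub>0 rat"

definition X :: "nat \<Rightarrow> rpoly" where
  "X i = Poly_Mapping.single (Poly_Mapping.single i 1) 1"

definition const_poly :: "rat \<Rightarrow> rpoly" where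
  "const_poly c = Poly_Mapping.single 0 c"

definition poly_carrier :: "nat \<Rightarrow> rpoly set" where
  "poly_carrier n = {p. \<forall>m \<in> Poly_Mapping.keys p. Poly_Mapping.keys m \<subseteq> {1..n}}"

definition poly_ring :: "nat \<Rightarrow> rpoly ring" where
  "poly_ring n = class_ring \<lparr>carrier := poly_carrier n\<rparr>"

definition elem_sym :: "nat \<Rightarrow> nat \<Rightarrow> rpoly" where
  "elem_sym n d = (\<Sum>S | S \<subseteq> {1..n} \<and> card S = d. \<Prod>i\<in>S. X i)"

definition I_ideal :: "nat \<Rightarrow> nat \<Rightarrow> rpoly set" where
  "I_ideal n k =
    Idl\<^bsub>poly_ring n\<^esub> ({X i ^ k |i. i \<in> {1..n}} \<union> {elem_sym n d |d. d \<in> {n - k + 1..n}})"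

definition R_class :: "nat \<Rightarrow> nat \<Rightarrow> rpoly \<Rightarrow> rpoly set" where
  "R_class n k p = I_ideal n k +>\<^bsub>poly_ring n\<^esub> p"

text \<open>
  The quotient ring with its vector space structure over the rationals: the scalar \<open>c\<close> acts as
  multiplication by the class of the constant polynomial \<open>c\<close>.
\<close>

definition R_quot :: "nat \<Rightarrow> nat \<Rightarrow> (rat, rpoly set) module" where
  "R_quot n k = ring.extend (poly_ring n Quot I_ideal n k)
    (module.fields (\<lambda>c U. R_class n k (const_poly c) \<otimes>\<^bsub>poly_ring n Quot I_ideal n k\<^esub> U))"

text \<open>
  A permutation \<open>\<pi>\<^sub>1 \<dots> \<pi>\<^sub>n\<close> in one-line notation is a function \<open>\<pi>\<close> with \<open>\<pi> permutes {1..n}\<close>.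
\<close>

definition Des :: "nat \<Rightarrow> (nat \<Rightarrow> nat) \<Rightarrow> nat set" where
  "Des n \<pi> = {i. 1 \<le> i \<and> i \<le> n - 1 \<and> \<pi> i > \<pi> (i + 1)}"

definition des :: "nat \<Rightarrow> (nat \<Rightarrow> nat) \<Rightarrow> nat" where
  "des n \<pi> = card (Des n \<pi>)"

definition gs :: "nat \<Rightarrow> (nat \<Rightarrow> nat) \<Rightarrow> rpoly" where
  "gs n \<pi> = (\<Prod>i\<in>Des n \<pi>. \<Prod>j\<in>{1..i}. X (\<pi> j))"

text \<open>
  The exponent sequence \<open>i\<^sub>1 \<ge> \<dots> \<ge> i\<^bsub>n-k\<^esub>\<close> is the restriction of a function \<open>a\<close> to \<open>{1..n - k}\<close>.
  For \<open>k = n\<close> it is empty.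
\<close>

definition GS :: "nat \<Rightarrow> nat \<Rightarrow> rpoly set" where
  "GS n k = {gs n \<pi> * (\<Prod>j\<in>{1..n - k}. X (\<pi> j) ^ a j) |\<pi> a.
     \<pi> permutes {1..n} \<and> des n \<pi> < k \<and>
     (\<forall>j\<in>{1..n - k}. a j < k - des n \<pi>) \<and> antimono_on {1..n - k} a}"

text \<open>
  The remaining lemmas confirm that these structures are what their names say; in particular
  the quotient is a vector space, so that the basis predicate of its locale is meaningful.
\<close>

lemma subcring_poly_carrier: "subcring (poly_carrier n) (class_ring :: rpoly ring)"
proof -
  have uminus: "a_inv (class_ring :: rpoly ring) = uminus"
    by (simp add: class_ring_simps)
  have "subring (poly_carrier n) (class_ring :: rpoly ring)"
  proof (rule ring.subringI[OF class_ring.ring_axioms])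
    fix f g :: rpoly assume f: "f \<in> poly_carrier n" and g: "g \<in> poly_carrier n"
    have "Poly_Mapping.keys m \<subseteq> {1..n}" if "m \<in> Poly_Mapping.keys (f * g)" for m
    proof -
      obtain a b where m: "m = a + b" and "a \<in> Poly_Mapping.keys f" "b \<in> Poly_Mapping.keys g"
        using \<open>m \<in> Poly_Mapping.keys (f * g)\<close> keys_mult[of f g] by blast
      then show ?thesis
        using f g keys_add[of a b] unfolding poly_carrier_def by blast
    qed
    then show "f \<otimes>\<^bsub>class_ring\<^esub> g \<in> poly_carrier n"
      by (simp add: poly_carrier_def)
    show "f \<oplus>\<^bsub>class_ring\<^esub> g \<in> poly_carrier n"
      using f g keys_add[of f g] by (auto simp: poly_carrier_def)
  qed (auto simp: poly_carrier_def uminus)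
  then show ?thesis
    by (rule cring.subcringI'[OF class_cring.is_cring])
qed

lemma cring_poly_ring: "cring (poly_ring n)"
  unfolding poly_ring_def
  using subcring_poly_carrier[of n] ring.subcring_iff[OF class_ring.ring_axioms, of "poly_carrier n"]
  by auto

lemma X_in_carrier: "i \<in> {1..n} \<Longrightarrow> X i \<in> poly_carrier n"
  by (auto simp: X_def poly_carrier_def)

lemma const_poly_in_carrier: "const_poly c \<in> poly_carrier n"
  by (auto simp: const_poly_def poly_carrier_def)

lemma power_in_poly_carrier: "p \<in> poly_carrier n \<Longrightarrow> p ^ j \<in> poly_carrier n"
  using subcringE(3,6)[OF subcring_poly_carrier[of n]] by (induction j) auto

lemma prod_in_poly_carrier:
  "(\<And>i. i \<in> S \<Longrightarrow> f i \<in> poly_carrier n) \<Longrightarrow> prod f S \<in> poly_carrier n"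
  using subcringE(3,6)[OF subcring_poly_carrier[of n]]
  by (induction S rule: infinite_finite_induct) auto

lemma sum_in_poly_carrier:
  "(\<And>i. i \<in> S \<Longrightarrow> f i \<in> poly_carrier n) \<Longrightarrow> sum f S \<in> poly_carrier n"
  using subcringE(2,7)[OF subcring_poly_carrier[of n]]
  by (induction S rule: infinite_finite_induct) auto

lemma carrier_poly_ring: "carrier (poly_ring n) = poly_carrier n"
  by (simp add: poly_ring_def)

lemma ideal_I_ideal: "ideal (I_ideal n k) (poly_ring n)"
proof -
  interpret P: cring "poly_ring n" by (rule cring_poly_ring)
  have "elem_sym n d \<in> poly_carrier n" for d
    unfolding elem_sym_def
    by (intro sum_in_poly_carrier prod_in_poly_carrier X_in_carrier) auto
  then show ?thesis
    unfolding I_ideal_def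
    by (intro P.genideal_ideal)
      (auto simp: carrier_poly_ring intro!: power_in_poly_carrier X_in_carrier)
qed

lemma GS_subset: assumes "k \<le> n" shows "GS n k \<subseteq> carrier (poly_ring n)"
proof
  fix p assume "p \<in> GS n k"
  then obtain \<pi> a where \<pi>: "\<pi> permutes {1..n}"
    and p: "p = gs n \<pi> * (\<Prod>j\<in>{1..n - k}. X (\<pi> j) ^ a j)"
    unfolding GS_def by blast
  have X: "X (\<pi> j) \<in> poly_carrier n" if "1 \<le> j" "j \<le> n" for j
    using permutes_in_image[OF \<pi>] that by (auto intro!: X_in_carrier simp del: atLeastAtMost_iff) auto
  have "gs n \<pi> \<in> poly_carrier n"
    unfolding gs_def by (intro prod_in_poly_carrier X) (auto simp: Des_def)
  moreover have "(\<Prod>j\<in>{1..n - k}. X (\<pi> j) ^ a j) \<in> poly_carrier n"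
    by (intro prod_in_poly_carrier power_in_poly_carrier X) auto
  ultimately show "p \<in> carrier (poly_ring n)"
    using subcringE(6)[OF subcring_poly_carrier[of n]] by (simp add: p carrier_poly_ring)
qed

lemma R_quot_sel:
  "carrier (R_quot n k) = carrier (poly_ring n Quot I_ideal n k)"
  "add (R_quot n k) = add (poly_ring n Quot I_ideal n k)"
  "zero (R_quot n k) = zero (poly_ring n Quot I_ideal n k)"
  "mult (R_quot n k) = mult (poly_ring n Quot I_ideal n k)"
  "one (R_quot n k) = one (poly_ring n Quot I_ideal n k)"
  "smult (R_quot n k) c U = R_class n k (const_poly c) \<otimes>\<^bsub>poly_ring n Quot I_ideal n k\<^esub> U"
  by (simp_all add: R_quot_def ring.defs module.defs)

lemma R_class_hom: "R_class n k \<in> Ring.ring_hom (poly_ring n) (poly_ring n Quot I_ideal n k)"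
  using ideal.rcos_ring_hom[OF ideal_I_ideal] unfolding R_class_def[abs_def] .

lemma vectorspace_R_quot: "vectorspace class_ring (R_quot n k)"
proof -
  let ?P = "poly_ring n" and ?Q = "poly_ring n Quot I_ideal n k"
  interpret Q: cring ?Q
    by (rule ideal.quotient_is_cring[OF ideal_I_ideal cring_poly_ring])
  note hom = ring_hom_closed[OF R_class_hom] ring_hom_mult[OF R_class_hom]
    ring_hom_add[OF R_class_hom] ring_hom_one[OF R_class_hom]
  have c: "R_class n k (const_poly c) \<in> carrier ?Q" for c
    by (rule hom(1)) (simp add: carrier_poly_ring const_poly_in_carrier)
  have cm: "R_class n k (const_poly (a * b))
      = R_class n k (const_poly a) \<otimes>\<^bsub>?Q\<^esub> R_class n k (const_poly b)" for a b
    using hom(2)[of "const_poly a" n "const_poly b" k]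
    by (simp add: carrier_poly_ring const_poly_in_carrier)
      (simp add: poly_ring_def const_poly_def mult_single)
  have ca: "R_class n k (const_poly (a + b))
      = R_class n k (const_poly a) \<oplus>\<^bsub>?Q\<^esub> R_class n k (const_poly b)" for a b
    using hom(3)[of "const_poly a" n "const_poly b" k]
    by (simp add: carrier_poly_ring const_poly_in_carrier)
      (simp add: poly_ring_def const_poly_def single_add)
  have c1: "R_class n k (const_poly 1) = \<one>\<^bsub>?Q\<^esub>"
    using hom(4)[of n k] by (simp add: poly_ring_def const_poly_def)
  have grp: "abelian_group (R_quot n k)"
  proof (rule abelian_groupI)
    show "\<exists>y\<in>carrier (R_quot n k). y \<oplus>\<^bsub>R_quot n k\<^esub> x = \<zero>\<^bsub>R_quot n k\<^esub>"
      if "x \<in> carrier (R_quot n k)" for x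
      using that Q.l_neg Q.a_inv_closed unfolding R_quot_sel by blast
  qed (simp_all add: R_quot_sel Q.a_ac)
  have "Module.module class_ring (R_quot n k)"
    by (rule module.intro[OF class_cring.is_cring grp], unfold_locales)
      (auto simp: R_quot_sel c cm ca c1 Q.l_distr Q.r_distr Q.m_assoc)
  then show ?thesis
    by (simp add: vectorspace_def class_field)
qed

end

theory Submission
  imports
    Defs
    "HOL-Computational_Algebra.Polynomial_FPS"
    "HOL-Library.Function_Algebras"
begin

text \<open>
  \<^emph>\<open>Spanning.\<close> Sort the exponents of a monomial by a permutation \<open>\<pi>\<close> and divide by \<open>gs\<^sub>\<pi>\<close>; the
  quotient has weakly decreasing exponents along \<open>\<pi>\<close>. Unless the monomial lies in \<open>GS n k\<close>, either
  some exponent is at least \<open>k\<close>, or it is the leading term of a product \<open>m' e\<^sub>d\<close> with \<open>d > n - k\<close>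
  for a suitable quadratic potential, and it can be replaced by monomials of the same degree and
  smaller potential.

  \<^emph>\<open>Independence.\<close> Let \<open>Y\<close> be the set of surjective words \<open>{1..n} \<rightarrow> {1..k}\<close>, seen as points of
  affine space. Every generator of the ideal is homogeneous and agrees on \<open>Y\<close> with a polynomial of
  smaller degree. Hence straightening also shows that \<open>GS n k\<close> spans the functions on \<open>Y\<close>. There
  are at most \<open>card Y\<close> such monomials, so they are independent on \<open>Y\<close>. The top-degree part of a
  relation modulo the ideal would be, on \<open>Y\<close>, a combination of monomials in \<open>GS n k\<close> of smaller
  degree, which is impossible.
\<close>

section \<open>Counting Garsia--Stanton monomials\<close>

text \<open>Both functions list their common image in increasing order, so they give the same sorted
  list. This later recovers a sequence from its set of values and a permutation from its block
  word.\<close>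

lemma strict_mono_on_image_unique:
  fixes f g :: "nat \<Rightarrow> 'a::linorder"
  assumes "strict_mono_on {1..r} f" "strict_mono_on {1..r} g" "f ` {1..r} = g ` {1..r}"
    and "j \<in> {1..r}"
  shows "f j = g j"
proof -
  have sorted: "sorted_wrt (<) (map h [1..<Suc r])" if "strict_mono_on {1..r} h"
    for h :: "nat \<Rightarrow> 'a"
    using that unfolding sorted_wrt_map sorted_wrt_upt
    by (intro sorted_wrt_mono_rel[OF _ sorted_wrt_upt])
      (auto simp: strict_mono_on_def)
  have "map f [1..<Suc r] = map g [1..<Suc r]"
    using assms(3) by (intro strict_sorted_equal sorted assms(1,2))
      (simp add: atLeastLessThanSuc_atLeastAtMost del: upt_Suc)
  then show ?thesis
    using \<open>j \<in> {1..r}\<close> by (simp del: upt_Suc)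
qed

lemma strict_mono_on_SucI:
  fixes f :: "nat \<Rightarrow> 'a::order"
  assumes "\<And>p. 1 \<le> p \<Longrightarrow> p < n \<Longrightarrow> f p < f (Suc p)"
  shows "strict_mono_on {1..n} f"
proof (rule strict_mono_onI)
  fix p q assume "p \<in> {1..n}" "q \<in> {1..n}" "p < q"
  from this(3,1,2) show "f p < f q"
  proof (induction p q rule: less_Suc_induct)
    case (1 i)
    then show ?case using assms by auto
  next
    case (2 i j l)
    then show ?case by (meson atLeastAtMost_iff less_imp_le order.strict_trans order_trans)
  qed
qed

lemma ex_permutes_sorting_decreasing:
  fixes \<kappa> :: "nat \<Rightarrow> nat"
  assumes "inj_on \<kappa> {1..n}"
  obtains \<pi> where "\<pi> permutes {1..n}"
    and "\<And>i j. 1 \<le> i \<Longrightarrow> i < j \<Longrightarrow> j \<le> n \<Longrightarrow> \<kappa> (\<pi> i) > \<kappa> (\<pi> j)"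
proof -
  obtain h where h: "bij_betw h {..<card (\<kappa> ` {1..n})} (\<kappa> ` {1..n})"
    and mono: "strict_mono_on {..<card (\<kappa> ` {1..n})} h"
    using ex_bij_betw_strict_mono_card[of "\<kappa> ` {1..n}"] by auto
  have card: "card (\<kappa> ` {1..n}) = n"
    using assms by (simp add: card_image)
  \<comment> \<open>\<open>h\<close> lists the keys increasingly from index 0, and
    \<open>n - j\<close> maps \<open>{1..n}\<close> onto \<open>{..<n}\<close> in reversed order, so
    position 1 receives the largest key.\<close>
  let ?g = "\<lambda>j. inv_into {1..n} \<kappa> (h (n - j))"
  define \<pi> where "\<pi> j = (if j \<in> {1..n} then ?g j else j)" for j
  have "bij_betw (\<lambda>j. n - j) {1..n} {..<n}"
    by (rule bij_betw_byWitness[where f' = "\<lambda>j. n - j"]) auto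
  then have "bij_betw (inv_into {1..n} \<kappa> \<circ> (h \<circ> (\<lambda>j. n - j))) {1..n} {1..n}"
    using h card bij_betw_inv_into[OF inj_on_imp_bij_betw[OF assms]]
    by (auto intro!: bij_betw_trans)
  then have "bij_betw \<pi> {1..n} {1..n}"
    by (rule bij_betw_cong[THEN iffD1, rotated]) (auto simp: \<pi>_def)
  then have "\<pi> permutes {1..n}"
    by (rule bij_imp_permutes) (auto simp: \<pi>_def)
  moreover have "\<kappa> (\<pi> i) > \<kappa> (\<pi> j)" if "1 \<le> i" "i < j" "j \<le> n" for i j
  proof -
    have "\<kappa> (\<pi> l) = h (n - l)" if "l \<in> {1..n}" for l
    proof -
      have "h (n - l) \<in> \<kappa> ` {1..n}"
        using h that unfolding bij_betw_def card by auto
      then show ?thesis using that by (simp add: \<pi>_def f_inv_into_f)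
    qed
    moreover have "h (n - j) < h (n - i)"
      using mono that unfolding card by (auto simp: strict_mono_on_def)
    ultimately show ?thesis using that by simp
  qed
  ultimately show ?thesis using that by blast
qed

section \<open>Surjective words, ascents and exponent sequences\<close>

definition surj_words :: "nat \<Rightarrow> nat \<Rightarrow> (nat \<Rightarrow> nat) set" where
  "surj_words n k = {y \<in> {1..n} \<rightarrow>\<^sub>E {1..k}. y ` {1..n} = {1..k}}"

lemma finite_surj_words: "finite (surj_words n k)"
  by (rule finite_subset[of _ "{1..n} \<rightarrow>\<^sub>E {1..k}"]) (auto simp: surj_words_def finite_PiE)

definition Asc :: "nat \<Rightarrow> (nat \<Rightarrow> nat) \<Rightarrow> nat set" where
  "Asc n \<pi> = {i. 1 \<le> i \<and> i \<le> n - 1 \<and> \<pi> i < \<pi> (i + 1)}"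

lemma card_Asc:
  assumes "\<pi> permutes {1..n}"
  shows "card (Asc n \<pi>) + des n \<pi> = n - 1"
proof -
  have "\<pi> i \<noteq> \<pi> (i + 1)" for i
    using inj_eq[OF permutes_inj[OF assms], of i "i + 1"] by simp
  then have "\<pi> i < \<pi> (i + 1) \<or> \<pi> i > \<pi> (i + 1)" for i
    by (meson nat_neq_iff)
  then have "Asc n \<pi> \<union> Des n \<pi> = {1..n-1}"
    unfolding Asc_def Des_def by fastforce
  moreover have "Asc n \<pi> \<inter> Des n \<pi> = {}"
    unfolding Asc_def Des_def by auto
  moreover have "finite (Asc n \<pi>)" "finite (Des n \<pi>)"
    by (auto simp: Asc_def Des_def)
  ultimately show ?thesis
    using card_Un_disjoint[of "Asc n \<pi>" "Des n \<pi>"] by (simp add: des_def)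
qed

text \<open>Stars and bars: complementing in \<open>s - 1\<close> makes the sequence weakly
  increasing, adding the index makes it strict, and a strictly increasing sequence is determined by
  its value set, here an \<open>r\<close>-subset of \<open>{1..r + s - 1}\<close>.\<close>

lemma card_bounded_antimono_le:
  assumes "s \<ge> 1"
  shows "card {a \<in> {1..r} \<rightarrow>\<^sub>E {0..<s}. antimono_on {1..r} a} \<le> (r + s - 1) choose r"
    (is "card ?A \<le> _")
proof -
  let ?b = "\<lambda>a j. (s - 1 - a j) + j"
  let ?h = "\<lambda>a. ?b a ` {1..r}"
  have b: "strict_mono_on {1..r} (?b a)" if "a \<in> ?A" for a
  proof (rule strict_mono_onI)
    fix i j assume "i \<in> {1..r}" "j \<in> {1..r}" "i < j"
    then have "a j \<le> a i" using that by (auto simp: monotone_on_def)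
    then show "?b a i < ?b a j" using \<open>i < j\<close> by simp
  qed
  have "inj_on ?h ?A"
  proof (rule inj_onI)
    fix a a' assume a: "a \<in> ?A" "a' \<in> ?A" and eq: "?h a = ?h a'"
    have "a j = a' j" if "j \<in> {1..r}" for j
    proof -
      have "a j < s" "a' j < s" using a that by (auto simp: PiE_iff)
      then show ?thesis
        using strict_mono_on_image_unique[OF b[OF a(1)] b[OF a(2)] eq that] by simp
    qed
    then show "a = a'" using a by (intro PiE_ext[of a _ _ a']) blast+
  qed
  moreover have "?h ` ?A \<subseteq> {M. M \<subseteq> {1..r+s-1} \<and> card M = r}"
  proof (rule image_subsetI)
    fix a assume a: "a \<in> ?A"
    have "card (?h a) = r"
      using strict_mono_on_imp_inj_on[OF b[OF a]] by (simp add: card_image)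
    then show "?h a \<in> {M. M \<subseteq> {1..r+s-1} \<and> card M = r}"
      using assms by auto
  qed
  ultimately have "card ?A \<le> card {M. M \<subseteq> {1..r+s-1} \<and> card M = r}"
    by (intro card_inj_on_le[of ?h]) auto
  then show ?thesis by (simp add: n_subsets)
qed

text \<open>
  Cutting the one-line notation of \<open>\<pi>\<close> after every position outside \<open>M\<close> gives an ordered set
  partition; the word records the block of each letter.
\<close>

definition block_word :: "nat \<Rightarrow> (nat \<Rightarrow> nat) \<Rightarrow> nat set \<Rightarrow> nat \<Rightarrow> nat" where
  "block_word n \<pi> M = restrict (\<lambda>i. 1 + card ({1..<inv_into UNIV \<pi> i} - M)) {1..n}"

lemma block_word_apply:
  assumes "\<pi> permutes {1..n}" "p \<in> {1..n}"
  shows "block_word n \<pi> M (\<pi> p) = 1 + card ({1..<p} - M)"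
  using assms permutes_in_image[OF assms(1), of p]
  by (simp add: block_word_def permutes_inverses)

lemma card_block_step:
  assumes "1 \<le> p"
  shows "card ({1..<Suc p} - M) = card ({1..<p} - M) + (if p \<in> M then 0 else 1)"
proof -
  have "{1..<Suc p} - M = (if p \<in> M then {1..<p} - M else insert p ({1..<p} - M))"
    using assms by (auto simp: less_Suc_eq)
  then show ?thesis by auto
qed

text \<open>Along the one-line notation the block number starts at 1, grows by at most 1 per step
  and ends at \<open>k\<close>, so it takes every value in between.\<close>

lemma block_word_surj:
  assumes \<pi>: "\<pi> permutes {1..n}" and M: "M \<subseteq> Asc n \<pi>" "card M = n - k"
    and "1 \<le> k" "k \<le> n"
  shows "block_word n \<pi> M \<in> surj_words n k"
proof -
  let ?c = "\<lambda>p. 1 + card ({1..<p} - M)"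
  have M': "M \<subseteq> {1..<n}" using M(1) by (auto simp: Asc_def)
  \<comment> \<open>Of the \<open>n - 1\<close> gaps exactly \<open>n - k\<close> lie in
    \<open>M\<close>, which leaves \<open>k - 1\<close> cuts.\<close>
  have cn: "?c n = k"
    using M' M(2) assms(4,5) by (subst card_Diff_subset) (auto intro: finite_subset)
  have img: "block_word n \<pi> M ` {1..n} = ?c ` {1..n}"
  proof -
    have "block_word n \<pi> M ` (\<pi> ` {1..n}) = ?c ` {1..n}"
      unfolding image_image by (intro image_cong refl block_word_apply[OF \<pi>])
    then show ?thesis by (simp only: permutes_image[OF \<pi>])
  qed
  have "?c ` {1..n} = {1..k}"
  proof
    show "?c ` {1..n} \<subseteq> {1..k}"
    proof (rule image_subsetI)
      fix p assume "p \<in> {1..n}"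
      then have "card ({1..<p} - M) \<le> card ({1..<n} - M)"
        by (intro card_mono) auto
      then show "?c p \<in> {1..k}" using cn by auto
    qed
    show "{1..k} \<subseteq> ?c ` {1..n}"
    proof
      fix v assume v: "v \<in> {1..k}"
      have "\<exists>p. 1 \<le> p \<and> p \<le> n \<and> int (?c p) = int v"
        using v cn assms(4,5) card_block_step[of _ M]
        by (intro nat_intermed_int_val) (auto simp del: of_nat_add)
      then obtain p where "p \<in> {1..n}" "v = ?c p" by auto
      then show "v \<in> ?c ` {1..n}" by (rule rev_image_eqI)
    qed
  qed
  then show ?thesis
    using img by (auto simp: surj_words_def block_word_def)
qed

text \<open>Since \<open>M\<close> consists of ascents, letters increase inside each block, so
  listing the letters by block and then by size gives back \<open>\<pi>\<close>. A position is in
  \<open>M\<close> exactly when the next letter lies in the same block.\<close>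

lemma block_word_inj:
  assumes \<pi>: "\<pi> permutes {1..n}" "M \<subseteq> Asc n \<pi>"
    and \<pi>': "\<pi>' permutes {1..n}" "M' \<subseteq> Asc n \<pi>'"
    and eq: "block_word n \<pi> M = block_word n \<pi>' M'"
  shows "\<pi> = \<pi>' \<and> M = M'"
proof -
  let ?y = "block_word n \<pi> M"
  \<comment> \<open>The lexicographic order on (block, letter), packed into one number: letters are
    at most \<open>n\<close>, so the letter is the last digit in base \<open>n + 1\<close>.\<close>
  let ?\<kappa> = "\<lambda>i. (n + 1) * ?y i + i"
  have mono: "strict_mono_on {1..n} (\<lambda>p. (n + 1) * block_word n \<sigma> L (\<sigma> p) + \<sigma> p)"
    if \<sigma>: "\<sigma> permutes {1..n}" "L \<subseteq> Asc n \<sigma>" for \<sigma> L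
  proof (rule strict_mono_on_SucI)
    fix p assume p: "1 \<le> p" "p < n"
    have w: "block_word n \<sigma> L (\<sigma> (Suc p))
        = block_word n \<sigma> L (\<sigma> p) + (if p \<in> L then 0 else 1)"
      using p card_block_step[of p L] by (simp add: block_word_apply[OF \<sigma>(1)])
    have "\<sigma> p \<le> n" using permutes_in_image[OF \<sigma>(1), of p] p by simp
    moreover have "p \<in> L \<Longrightarrow> \<sigma> p < \<sigma> (Suc p)" using \<sigma>(2) by (auto simp: Asc_def)
    ultimately show "(n + 1) * block_word n \<sigma> L (\<sigma> p) + \<sigma> p
        < (n + 1) * block_word n \<sigma> L (\<sigma> (Suc p)) + \<sigma> (Suc p)"
      unfolding w by (cases "p \<in> L") (simp_all add: algebra_simps)
  qed
  have image: "(\<lambda>p. ?\<kappa> (\<sigma> p)) ` {1..n} = ?\<kappa> ` {1..n}" if "\<sigma> permutes {1..n}" for \<sigma>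
    unfolding image_image[of ?\<kappa> \<sigma>, symmetric] permutes_image[OF that] ..
  have \<kappa>: "?\<kappa> (\<pi> p) = ?\<kappa> (\<pi>' p)" if "p \<in> {1..n}" for p
    by (rule strict_mono_on_image_unique[OF mono[OF \<pi>] mono[OF \<pi>', folded eq] _ that])
      (simp only: image[OF \<pi>(1)] image[OF \<pi>'(1)])
  have eq\<pi>: "\<pi> p = \<pi>' p" if "p \<in> {1..n}" for p
  proof -
    have "\<pi> p \<le> n" "\<pi>' p \<le> n"
      using permutes_in_image[OF \<pi>(1), of p] permutes_in_image[OF \<pi>'(1), of p] that by auto
    moreover have "((n + 1) * c + d) mod (n + 1) = d" if "d \<le> n" for c d :: nat
      unfolding mod_mult_self4 using that by (intro mod_less) simp
    ultimately show ?thesis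
      using arg_cong[OF \<kappa>[OF that], of "\<lambda>x. x mod (n + 1)"] by (simp only:)
  qed
  have "\<pi> = \<pi>'"
  proof
    show "\<pi> p = \<pi>' p" for p
      using eq\<pi> \<pi>(1) \<pi>'(1) by (cases "p \<in> {1..n}") (auto simp: permutes_not_in)
  qed
  have M: "L = {p. 1 \<le> p \<and> p < n \<and> block_word n \<sigma> L (\<sigma> p) = block_word n \<sigma> L (\<sigma> (Suc p))}"
    if \<sigma>: "\<sigma> permutes {1..n}" "L \<subseteq> Asc n \<sigma>" for \<sigma> L
  proof -
    have "block_word n \<sigma> L (\<sigma> p) = block_word n \<sigma> L (\<sigma> (Suc p)) \<longleftrightarrow> p \<in> L"
      if "1 \<le> p" "p < n" for p
      using that card_block_step[of p L] by (simp add: block_word_apply[OF \<sigma>(1)])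
    then show ?thesis using \<sigma>(2) by (fastforce simp: Asc_def)
  qed
  show ?thesis
    using M[OF \<pi>] M[OF \<pi>'] eq \<open>\<pi> = \<pi>'\<close> by simp
qed

text \<open>The comparison is made permutation by permutation. There are at most
  \<open>(n - 1 - des n \<pi>) choose (n - k)\<close> exponent sequences, which is the number of
  ways to choose \<open>n - k\<close> ascents of \<open>\<pi>\<close>; these choices inject into the
  words.\<close>

lemma card_GS_le:
  assumes "1 \<le> k" "k \<le> n"
  shows "finite (GS n k)" and "card (GS n k) \<le> card (surj_words n k)"
proof -
  define P where "P = {\<pi>. \<pi> permutes {1..n} \<and> des n \<pi> < k}"
  define A where "A \<pi> = {a \<in> {1..n-k} \<rightarrow>\<^sub>E {0..<k - des n \<pi>}. antimono_on {1..n-k} a}" for \<pi>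
  define B where "B \<pi> = {M. M \<subseteq> Asc n \<pi> \<and> card M = n - k}" for \<pi>
  let ?mono = "\<lambda>(\<pi>, a). gs n \<pi> * (\<Prod>j\<in>{1..n - k}. X (\<pi> j) ^ a j)"
  have finP: "finite P"
    by (rule finite_subset[OF _ finite_permutations[of "{1..n}"]]) (auto simp: P_def)
  have finA: "finite (A \<pi>)" for \<pi>
    by (rule finite_subset[of _ "{1..n-k} \<rightarrow>\<^sub>E {0..<k - des n \<pi>}"]) (auto simp: A_def finite_PiE)
  have finAsc: "finite (Asc n \<pi>)" for \<pi>
    by (auto simp: Asc_def)
  have finB: "finite (B \<pi>)" for \<pi>
    using finAsc by (auto simp: B_def)
  have sub: "GS n k \<subseteq> ?mono ` Sigma P A"
  proof
    fix p assume "p \<in> GS n k"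
    then obtain \<pi> a where \<pi>: "\<pi> \<in> P" and a: "\<forall>j\<in>{1..n - k}. a j < k - des n \<pi>"
        "antimono_on {1..n - k} a"
      and p: "p = gs n \<pi> * (\<Prod>j\<in>{1..n - k}. X (\<pi> j) ^ a j)"
      unfolding GS_def P_def by blast
    \<comment> \<open>Exponent functions in \<open>GS\<close> take arbitrary values off
      \<open>{1..n - k}\<close>; restricting them makes the index set finite.\<close>
    have "restrict a {1..n-k} \<in> A \<pi>"
      using a by (auto simp: A_def monotone_on_def)
    moreover have "p = ?mono (\<pi>, restrict a {1..n-k})"
      by (simp add: p)
    ultimately show "p \<in> ?mono ` Sigma P A"
      using \<pi> by blast
  qed
  have finS: "finite (Sigma P A)" using finP finA by auto
  then show "finite (GS n k)" using sub by (auto intro: finite_subset)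
  have "card (GS n k) \<le> card (Sigma P A)"
    using card_mono[OF _ sub] card_image_le[of "Sigma P A" ?mono] finS by fastforce
  also have "\<dots> = (\<Sum>\<pi>\<in>P. card (A \<pi>))"
    using finP finA by simp
  also have "\<dots> \<le> (\<Sum>\<pi>\<in>P. card (B \<pi>))"
  proof (rule sum_mono)
    fix \<pi> assume \<pi>: "\<pi> \<in> P"
    have "card (A \<pi>) \<le> (n - k + (k - des n \<pi>) - 1) choose (n - k)"
      unfolding A_def using \<pi> by (intro card_bounded_antimono_le) (auto simp: P_def)
    also have "n - k + (k - des n \<pi>) - 1 = card (Asc n \<pi>)"
      using card_Asc[of \<pi> n] \<pi> assms by (auto simp: P_def)
    finally show "card (A \<pi>) \<le> card (B \<pi>)"
      by (simp add: B_def n_subsets[OF finAsc])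
  qed
  also have "\<dots> = card (Sigma P B)"
    using finP finB by simp
  also have "\<dots> \<le> card (surj_words n k)"
  proof (rule card_inj_on_le[of "\<lambda>(\<pi>, M). block_word n \<pi> M"])
    show "inj_on (\<lambda>(\<pi>, M). block_word n \<pi> M) (Sigma P B)"
    proof (rule inj_onI, clarify)
      fix \<pi> M \<pi>' M'
      assume "\<pi> \<in> P" "M \<in> B \<pi>" "\<pi>' \<in> P" "M' \<in> B \<pi>'"
        and "block_word n \<pi> M = block_word n \<pi>' M'"
      then show "\<pi> = \<pi>' \<and> M = M'"
        by (intro block_word_inj[of \<pi> n M \<pi>' M']) (simp_all add: P_def B_def)
    qed
    show "(\<lambda>(\<pi>, M). block_word n \<pi> M) ` Sigma P B \<subseteq> surj_words n k"
      using assms by (auto simp: P_def B_def intro!: block_word_surj)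
    show "finite (surj_words n k)" by (rule finite_surj_words)
  qed
  finally show "card (GS n k) \<le> card (surj_words n k)" .
qed

section \<open>Polynomials on surjective words\<close>

abbreviation lookup :: "('a \<Rightarrow>\<^sub>0 'b::zero) \<Rightarrow> 'a \<Rightarrow> 'b" where
  "lookup \<equiv> Poly_Mapping.lookup"

abbreviation mon :: "(nat \<Rightarrow>\<^sub>0 nat) \<Rightarrow> rpoly" where
  "mon m \<equiv> Poly_Mapping.single m 1"

definition expos :: "nat \<Rightarrow> (nat \<Rightarrow>\<^sub>0 nat) set" where
  "expos n = {m. Poly_Mapping.keys m \<subseteq> {1..n}}"

text \<open>On \<open>expos n\<close> this is the total degree.\<close>

definition tdeg :: "nat \<Rightarrow> (nat \<Rightarrow>\<^sub>0 nat) \<Rightarrow> nat" where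
  "tdeg n m = (\<Sum>i\<in>{1..n}. lookup m i)"

definition indic :: "nat set \<Rightarrow> nat \<Rightarrow>\<^sub>0 nat" where
  "indic S = (\<Sum>i\<in>S. Poly_Mapping.single i 1)"

lemma tdeg_add: "tdeg n (m + m') = tdeg n m + tdeg n m'"
  by (simp add: tdeg_def lookup_add sum.distrib)

lemma expos_add: "m \<in> expos n \<Longrightarrow> m' \<in> expos n \<Longrightarrow> m + m' \<in> expos n"
  using keys_add[of m m'] by (auto simp: expos_def)

lemma mon_mult: "mon m * mon m' = mon (m + m')"
  by (simp add: mult_single)

lemma lookup_indic: "finite S \<Longrightarrow> lookup (indic S) i = (if i \<in> S then 1 else 0)"
  by (simp add: indic_def lookup_sum lookup_single when_def)

lemma indic_expos: "S \<subseteq> {1..n} \<Longrightarrow> indic S \<in> expos n"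
  using finite_subset[of S "{1..n}"] by (auto simp: expos_def in_keys_iff lookup_indic split: if_splits)

lemma tdeg_indic: "S \<subseteq> {1..n} \<Longrightarrow> tdeg n (indic S) = card S"
  using finite_subset[of S "{1..n}"]
  by (simp add: tdeg_def lookup_indic sum.If_cases Int_absorb1)

lemma prod_X_eq: "finite S \<Longrightarrow> (\<Prod>i\<in>S. X i) = mon (indic S)"
  by (induction S rule: finite_induct) (simp_all add: indic_def X_def mult_single)

lemma X_power_eq: "X i ^ j = mon (Poly_Mapping.single i j)"
  by (induction j) (simp_all add: X_def mult_single flip: single_add)

lemma elem_sym_eq: "elem_sym n d = (\<Sum>S | S \<subseteq> {1..n} \<and> card S = d. mon (indic S))"
  unfolding elem_sym_def by (intro sum.cong refl prod_X_eq) (auto intro: finite_subset)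

text \<open>A polynomial is the sum of its terms. The \<open>single\<close> case offers only
  exponents occurring in \<open>p\<close>, so that an induction can stay inside
  \<open>poly_carrier n\<close>.\<close>

lemma rpoly_induct [case_names zero single add]:
  fixes p :: rpoly
  assumes "P 0" and single: "\<And>m c. m \<in> Poly_Mapping.keys p \<Longrightarrow> P (Poly_Mapping.single m c)"
    and add: "\<And>f g. P f \<Longrightarrow> P g \<Longrightarrow> P (f + g)"
  shows "P p"
proof -
  have p: "p = (\<Sum>m\<in>Poly_Mapping.keys p. Poly_Mapping.single m (lookup p m))"
    by (rule poly_mapping_eqI)
      (auto simp: lookup_sum lookup_single when_def in_keys_iff)
  have "P (\<Sum>m\<in>A. Poly_Mapping.single m (lookup p m))" if "A \<subseteq> Poly_Mapping.keys p" for A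
    using finite_subset[OF that finite_keys] that
    by (induction A rule: finite_induct) (auto intro: assms)
  then show ?thesis by (subst p) auto
qed

lemma const_poly_mult: "const_poly (a * b) = const_poly a * const_poly b"
  by (simp add: const_poly_def mult_single)

lemma const_poly_add: "const_poly (a + b) = const_poly a + const_poly b"
  by (simp add: const_poly_def single_add)

lemma const_poly_1 [simp]: "const_poly 1 = 1"
  by (simp add: const_poly_def)

lemma const_poly_times_single:
  "const_poly c * Poly_Mapping.single m a = Poly_Mapping.single m (c * a)"
  by (simp add: const_poly_def mult_single)

abbreviation scl :: "rat \<Rightarrow> rpoly \<Rightarrow> rpoly" where
  "scl c p \<equiv> const_poly c * p"

interpretation poly_vs: vector_space scl
  by unfold_locales (simp_all add: algebra_simps const_poly_mult const_poly_add)

section \<open>Evaluation at a point\<close>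

definition peval :: "nat \<Rightarrow> (nat \<Rightarrow> nat) \<Rightarrow> rpoly \<Rightarrow> rat" where
  "peval n y p = (\<Sum>m\<in>Poly_Mapping.keys p. lookup p m * (\<Prod>i\<in>{1..n}. of_nat (y i) ^ lookup m i))"

lemma peval_superset:
  assumes "finite A" "Poly_Mapping.keys p \<subseteq> A"
  shows "peval n y p = (\<Sum>m\<in>A. lookup p m * (\<Prod>i\<in>{1..n}. of_nat (y i) ^ lookup m i))"
  unfolding peval_def using assms by (intro sum.mono_neutral_left) (auto simp: in_keys_iff)

lemma peval_0 [simp]: "peval n y 0 = 0"
  by (simp add: peval_def)

lemma peval_add: "peval n y (p + q) = peval n y p + peval n y q"
proof -
  let ?A = "Poly_Mapping.keys p \<union> Poly_Mapping.keys q"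
  have "Poly_Mapping.keys (p + q) \<subseteq> ?A" by (rule keys_add)
  then show ?thesis
    by (simp add: peval_superset[of ?A] lookup_add algebra_simps sum.distrib)
qed

lemma peval_single:
  "peval n y (Poly_Mapping.single m c) = c * (\<Prod>i\<in>{1..n}. of_nat (y i) ^ lookup m i)"
  by (subst peval_superset[of "{m}"]) auto

lemma peval_mult: "peval n y (p * q) = peval n y p * peval n y q"
proof (induction p rule: rpoly_induct)
  case (single m c)
  show ?case
    by (induction q rule: rpoly_induct)
      (simp_all add: mult_single peval_single peval_add lookup_add power_add prod.distrib algebra_simps)
qed (simp_all add: peval_add algebra_simps)

lemma peval_const [simp]: "peval n y (const_poly c) = c"
  by (simp add: const_poly_def peval_single)

lemma peval_uminus: "peval n y (- p) = - peval n y p"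
  using peval_add[of n y "- p" p] by simp

lemma peval_minus: "peval n y (p - q) = peval n y p - peval n y q"
  using peval_add[of n y "p - q" q] by simp

lemma peval_sum: "peval n y (\<Sum>i\<in>A. f i) = (\<Sum>i\<in>A. peval n y (f i))"
  by (induction A rule: infinite_finite_induct) (simp_all add: peval_add)

lemma peval_1 [simp]: "peval n y 1 = 1"
  using peval_const[of n y 1] by simp

lemma peval_prod: "peval n y (\<Prod>i\<in>A. f i) = (\<Prod>i\<in>A. peval n y (f i))"
  by (induction A rule: infinite_finite_induct) (simp_all add: peval_mult)

lemma peval_power: "peval n y (p ^ j) = peval n y p ^ j"
  by (induction j) (simp_all add: peval_mult)

lemma peval_X: "i \<in> {1..n} \<Longrightarrow> peval n y (X i) = of_nat (y i)"
proof -
  assume i: "i \<in> {1..n}"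
  have "peval n y (X i) = (\<Prod>j\<in>{1..n}. if i = j then of_nat (y j) else 1)"
    unfolding X_def peval_single mult_1_left
    by (intro prod.cong) (auto simp: lookup_single when_def)
  then show ?thesis using i by simp
qed

section \<open>Degree modulo polynomials vanishing on the words\<close>

definition vanishing :: "nat \<Rightarrow> nat \<Rightarrow> rpoly set" where
  "vanishing n k = {p. \<forall>y\<in>surj_words n k. peval n y p = 0}"

lemma subspace_vanishing: "poly_vs.subspace (vanishing n k)"
  by (auto simp: poly_vs.subspace_def vanishing_def peval_add peval_mult)

definition low :: "nat \<Rightarrow> nat \<Rightarrow> rpoly set" where
  "low n D = poly_vs.span {mon m |m. m \<in> expos n \<and> tdeg n m < D}"

text \<open>The polynomials that coincide on the surjective words with one of degree below
  \<open>D\<close>: the degree filtration of the functions on the words, pulled back to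
  polynomials.\<close>

definition lowv :: "nat \<Rightarrow> nat \<Rightarrow> nat \<Rightarrow> rpoly set" where
  "lowv n k D = {p + q |p q. p \<in> low n D \<and> q \<in> vanishing n k}"

lemma subspace_lowv: "poly_vs.subspace (lowv n k D)"
  unfolding lowv_def low_def
  by (intro poly_vs.subspace_sums subspace_vanishing poly_vs.subspace_span)

lemma mon_in_low: "m \<in> expos n \<Longrightarrow> tdeg n m < D \<Longrightarrow> mon m \<in> low n D"
  unfolding low_def by (rule poly_vs.span_base) auto

lemma low_mono: "D \<le> D' \<Longrightarrow> low n D \<subseteq> low n D'"
  unfolding low_def by (rule poly_vs.span_mono) auto

lemma low_subset_lowv: "low n D \<subseteq> lowv n k D"
  using poly_vs.subspace_0[OF subspace_vanishing[of n k]] unfolding lowv_def by force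

lemma lowvI: "h \<in> low n D \<Longrightarrow> (\<And>y. y \<in> surj_words n k \<Longrightarrow> peval n y p = peval n y h) \<Longrightarrow> p \<in> lowv n k D"
  unfolding lowv_def vanishing_def
  by (simp, rule exI[of _ h], rule exI[of _ "p - h"]) (simp add: peval_minus)

text \<open>Multiplication by a monomial shifts degrees by \<open>tdeg n m\<close> and preserves
  vanishing, so the degree drop of a generator on the words passes to its multiples.\<close>

lemma mon_mult_lowv:
  assumes "m \<in> expos n" "p \<in> lowv n k D"
  shows "mon m * p \<in> lowv n k (tdeg n m + D)"
proof -
  obtain h z where h: "h \<in> low n D" and z: "z \<in> vanishing n k" and p: "p = h + z"
    using assms(2) unfolding lowv_def by blast
  have "low n D \<subseteq> {h. mon m * h \<in> low n (tdeg n m + D)}"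
    unfolding low_def
  proof (rule poly_vs.span_minimal)
    show "poly_vs.subspace {h. mon m * h \<in> poly_vs.span {mon m' |m'. m' \<in> expos n \<and> tdeg n m' < tdeg n m + D}}"
      using poly_vs.span_add poly_vs.span_scale poly_vs.span_zero
      by (auto simp: poly_vs.subspace_def distrib_left mult.left_commute[of "mon m"])
    show "{mon m' |m'. m' \<in> expos n \<and> tdeg n m' < D}
        \<subseteq> {h. mon m * h \<in> poly_vs.span {mon m' |m'. m' \<in> expos n \<and> tdeg n m' < tdeg n m + D}}"
      using expos_add[OF assms(1)] by (auto simp: mon_mult tdeg_add intro!: poly_vs.span_base)
  qed
  then have "mon m * h \<in> low n (tdeg n m + D)" using h by blast
  moreover have "mon m * z \<in> vanishing n k"
    using z by (simp add: vanishing_def peval_mult)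
  ultimately show ?thesis unfolding p distrib_left lowv_def by blast
qed

lemma X_power_in_low: "i \<in> {1..n} \<Longrightarrow> j < D \<Longrightarrow> X i ^ j \<in> low n D"
  unfolding X_power_eq
  by (rule mon_in_low) (auto simp: expos_def tdeg_def lookup_single when_def keys_single)

lemma elem_sym_in_low: "d < D \<Longrightarrow> elem_sym n d \<in> low n D"
  unfolding elem_sym_eq low_def
  by (intro poly_vs.span_sum poly_vs.span_base) (auto simp: indic_expos tdeg_indic)

text \<open>A coordinate of a surjective word is a root of the monic polynomial
  \<open>(t - 1) \<dots> (t - k)\<close>.\<close>

lemma X_power_in_lowv:
  assumes "i \<in> {1..n}"
  shows "X i ^ k \<in> lowv n k k"
proof -
  define Q :: "rat poly" where "Q = (\<Prod>j\<in>{1..k}. [:- of_nat j, 1:])"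
  have deg: "degree Q = k" unfolding Q_def
    by (subst degree_prod_eq_sum_degree) auto
  have lead: "Polynomial.coeff Q k = 1"
  proof -
    have "lead_coeff Q = 1" unfolding Q_def by (simp add: lead_coeff_prod)
    then show ?thesis by (simp add: deg)
  qed
  \<comment> \<open>\<open>Q\<close> is monic with root \<open>y i\<close>, so the top power equals
    minus the lower terms. The coefficients of \<open>Q\<close> do not depend on the word, so one
    \<open>h\<close> serves all words.\<close>
  define h where "h = (\<Sum>j<k. scl (- Polynomial.coeff Q j) (X i ^ j))"
  show ?thesis
  proof (rule lowvI)
    show "h \<in> low n k"
      unfolding h_def low_def
      by (intro poly_vs.span_sum poly_vs.span_scale)
        (use X_power_in_low[OF assms] in \<open>auto simp: low_def\<close>)
    fix y assume y: "y \<in> surj_words n k"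
    let ?t = "of_nat (y i) :: rat"
    have "y i \<in> {1..k}" using y assms by (auto simp: surj_words_def)
    then have "poly Q ?t = 0" by (auto simp: Q_def poly_prod intro!: prod_zero)
    moreover have "poly Q ?t = (\<Sum>j<k. Polynomial.coeff Q j * ?t ^ j) + ?t ^ k"
      by (simp add: poly_altdef deg lead flip: lessThan_Suc_atMost)
    ultimately show "peval n y (X i ^ k) = peval n y h"
      by (simp add: h_def peval_sum peval_mult peval_power peval_X[OF assms] peval_uminus sum_negf add_eq_0_iff2)
  qed
qed

lemma prod_fps_const_times_X:
  "finite S \<Longrightarrow> (\<Prod>i\<in>S. fps_const (c i) * fps_X) = fps_const (\<Prod>i\<in>S. c i) * (fps_X :: 'a::comm_ring_1 fps) ^ card S"
  by (induction S rule: finite_induct) (simp_all add: algebra_simps flip: fps_const_mult)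

text \<open>Vieta: in the expanded product, picking the non-constant summand for the indices in
  \<open>S\<close> contributes to the power \<open>card S\<close> of the formal variable.\<close>

lemma peval_elem_sym:
  "peval n y (elem_sym n d) = fps_nth (\<Prod>i\<in>{1..n}. 1 + fps_const (of_nat (y i)) * fps_X) d"
proof -
  have "fps_nth (\<Prod>i\<in>{1..n}. fps_const (of_nat (y i) :: rat) * fps_X + 1) d
      = (\<Sum>S\<in>Pow {1..n}. fps_nth (fps_const (\<Prod>i\<in>S. of_nat (y i)) * fps_X ^ card S) d)"
    unfolding prod_add[OF finite_atLeastAtMost] fps_sum_nth
  proof (intro sum.cong refl)
    fix S assume "S \<in> Pow {1..n}"
    then have "finite S" by (auto intro: finite_subset)
    then show "fps_nth ((\<Prod>i\<in>S. fps_const (of_nat (y i) :: rat) * fps_X) * (\<Prod>i\<in>{1..n} - S. 1)) d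
        = fps_nth (fps_const (\<Prod>i\<in>S. of_nat (y i)) * fps_X ^ card S) d"
      by (simp only: prod_fps_const_times_X prod.neutral_const mult_1_right)
  qed
  also have "\<dots> = (\<Sum>S\<in>Pow {1..n}. if card S = d then \<Prod>i\<in>S. of_nat (y i) else 0)"
    by (intro sum.cong refl) (auto simp: fps_X_power_nth)
  also have "\<dots> = (\<Sum>S | S \<subseteq> {1..n} \<and> card S = d. \<Prod>i\<in>S. of_nat (y i))"
    by (subst sum.inter_filter[symmetric]) (auto simp: Pow_def)
  also have "\<dots> = peval n y (elem_sym n d)"
    unfolding elem_sym_def peval_sum peval_prod
    by (intro sum.cong prod.cong refl peval_X[symmetric]) auto
  finally show ?thesis by (simp add: add.commute)
qed

text \<open>
  On a surjective word the generating function of the elementary symmetric polynomials is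
  divisible by \<open>(1 + t) (1 + 2 t) \<dots> (1 + k t)\<close>, with a quotient of degree \<open>n - k\<close>.
\<close>

lemma elem_sym_in_lowv:
  assumes d: "d \<in> {n - k + 1..n}" and "k \<le> n"
  shows "elem_sym n d \<in> lowv n k d"
proof -
  define D :: "rat fps" where "D = (\<Prod>j\<in>{1..k}. 1 + fps_const (of_nat j) * fps_X)"
  \<comment> \<open>\<open>H\<close> does not depend on the word. Multiplied by the generating
    function of any word it gives a polynomial of degree at most \<open>n - k\<close>, whose
    coefficient at \<open>d\<close> vanishes.\<close>
  define H where "H = inverse D"
  have D0: "fps_nth D 0 = 1"
    unfolding D_def by (induction k) simp_all
  have DH: "D * H = 1" using D0 by (simp add: H_def inverse_mult_eq_1')
  have H0: "fps_nth H 0 = 1" by (simp add: H_def D0)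
  \<comment> \<open>The vanishing coefficient of that product, solved for the \<open>d\<close>-th
    elementary symmetric polynomial; this uses that \<open>H\<close> has constant term 1.\<close>
  define h where "h = (\<Sum>j=1..d. scl (- fps_nth H j) (elem_sym n (d - j)))"
  show ?thesis
  proof (rule lowvI)
    show "h \<in> low n d"
      unfolding h_def low_def
      by (intro poly_vs.span_sum poly_vs.span_scale)
        (use elem_sym_in_low in \<open>auto simp: low_def\<close>)
    fix y assume y: "y \<in> surj_words n k"
    define E :: "rat fps" where "E = (\<Prod>i\<in>{1..n}. 1 + fps_const (of_nat (y i)) * fps_X)"
    from y have img: "y ` {1..n} = {1..k}" by (simp add: surj_words_def)
    \<comment> \<open>\<open>T\<close> picks one position for each letter. Its factors multiply to
      \<open>D\<close>, and the remaining \<open>n - k\<close> factors form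
      \<open>r\<close>.\<close>
    then obtain T where T: "T \<subseteq> {1..n}" "inj_on y T" "y ` T = {1..k}"
      by (metis subset_image_inj subset_refl)
    have cT: "card T = k" using T card_image[of y T] by simp
    define r :: "rat poly" where "r = (\<Prod>i\<in>{1..n} - T. [:1, of_nat (y i):])"
    have "degree r \<le> (\<Sum>i\<in>{1..n} - T. degree [:1, of_nat (y i) :: rat:])"
      unfolding r_def by (rule degree_prod_sum_le[unfolded o_def]) simp
    also have "\<dots> \<le> (\<Sum>i\<in>{1..n} - T. 1)" by (intro sum_mono) simp
    also have "\<dots> = n - k" using T(1) cT by (simp add: card_Diff_subset finite_subset)
    finally have degr: "degree r \<le> n - k" .
    have "(\<Prod>i\<in>T. 1 + fps_const (of_nat (y i)) * fps_X) = D"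
      unfolding D_def T(3)[symmetric] using T(2) by (simp add: prod.reindex)
    moreover have "(\<Prod>i\<in>{1..n} - T. 1 + fps_const (of_nat (y i)) * fps_X) = fps_of_poly r"
      by (simp add: r_def fps_of_poly_prod fps_of_poly_pCons mult.commute)
    ultimately have "E = fps_of_poly r * D"
      unfolding E_def by (subst prod.subset_diff[OF T(1)]) simp_all
    then have "H * E = fps_of_poly r" using DH by (simp add: mult.assoc mult.commute)
    then have "fps_nth (H * E) d = 0"
      using d degr by (simp add: coeff_eq_0)
    then have "fps_nth E d + (\<Sum>j=1..d. fps_nth H j * fps_nth E (d - j)) = 0"
      by (simp add: fps_mult_nth sum.atLeast_Suc_atMost H0)
    moreover have "peval n y (elem_sym n c) = fps_nth E c" for c
      by (simp only: peval_elem_sym E_def)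
    ultimately show "peval n y (elem_sym n d) = peval n y h"
      by (simp add: h_def peval_sum peval_mult peval_uminus sum_negf add_eq_0_iff2)
  qed
qed

section \<open>Straightening\<close>

text \<open>Pair \<open>S - T\<close> with \<open>T - S\<close> by a bijection; every exchange
  raises the weight. Applied to keys, a set holding the largest keys has the largest key sum among
  sets of its size.\<close>

lemma sum_less_sum_top:
  fixes f :: "'a \<Rightarrow> nat"
  assumes fin: "finite S" "finite T" and card: "card S = card T" and "S \<noteq> T"
    and less: "\<And>i j. i \<in> T - S \<Longrightarrow> j \<in> S - T \<Longrightarrow> f j < f i"
  shows "sum f S < sum f T"
proof -
  have c: "card (S - T) = card (T - S)"
    using card fin by (metis Int_commute card_Diff_subset_Int finite_Int)
  then obtain h where h: "bij_betw h (S - T) (T - S)"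
    using fin by (metis finite_Diff finite_same_card_bij)
  have ne: "S - T \<noteq> {}"
    using c \<open>S \<noteq> T\<close> fin by (metis Diff_eq_empty_iff card_0_eq card.empty finite_Diff subset_antisym)
  have "sum f (S - T) < sum (\<lambda>j. f (h j)) (S - T)"
    using fin ne h by (intro sum_strict_mono less) (auto dest: bij_betwE)
  also have "\<dots> = sum f (T - S)"
    by (rule sum.reindex_bij_betw[OF h])
  finally have "sum f (S - T) < sum f (T - S)" .
  moreover have "sum f S = sum f (S \<inter> T) + sum f (S - T)" "sum f T = sum f (S \<inter> T) + sum f (T - S)"
    using fin sum.Int_Diff[of S f T] sum.Int_Diff[of T f S] by (simp_all add: Int_commute)
  ultimately show ?thesis by simp
qed

text \<open>
  Adding 1 to the exponents in \<open>S\<close> increases the potential by \<open>n * card S\<close> plus twice the sum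
  of the keys over \<open>S\<close>. Sorting by decreasing key is sorting by decreasing exponent, with ties
  broken by increasing index.
\<close>

definition potential :: "nat \<Rightarrow> (nat \<Rightarrow>\<^sub>0 nat) \<Rightarrow> nat" where
  "potential n m = (\<Sum>i\<in>{1..n}. n * (lookup m i)\<^sup>2 + 2 * (n - i) * lookup m i)"

definition key :: "nat \<Rightarrow> (nat \<Rightarrow>\<^sub>0 nat) \<Rightarrow> nat \<Rightarrow> nat" where
  "key n m i = n * lookup m i + (n - i)"

lemma potential_add_indic:
  assumes "S \<subseteq> {1..n}"
  shows "potential n (m + indic S) = potential n m + n * card S + 2 * (\<Sum>i\<in>S. key n m i)"
proof -
  have fin: "finite S" using assms finite_subset by blast
  have inc: "n * (Suc l)\<^sup>2 + 2 * c * Suc l = (n * l\<^sup>2 + 2 * c * l) + (n + 2 * (n * l + c))" for l c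
    by (simp add: power2_eq_square algebra_simps)
  have "potential n (m + indic S)
      = (\<Sum>i\<in>{1..n}. (n * (lookup m i)\<^sup>2 + 2 * (n - i) * lookup m i)
          + (if i \<in> S then n + 2 * key n m i else 0))"
    unfolding potential_def
    by (intro sum.cong refl)
      (simp add: lookup_add lookup_indic[OF fin] key_def inc del: power_Suc mult_Suc_right)
  also have "\<dots> = potential n m + (\<Sum>i\<in>S. n + 2 * key n m i)"
    using assms by (simp add: potential_def sum.distrib sum.If_cases Int_absorb1)
  also have "\<dots> = potential n m + n * card S + 2 * (\<Sum>i\<in>S. key n m i)"
    by (simp add: sum.distrib sum_distrib_left)
  finally show ?thesis .
qed

text \<open>\<open>n - i\<close> is the last digit of the key in base \<open>n\<close>, so the key
  determines the index.\<close>

lemma inj_on_key: "inj_on (key n m) {1..n}"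
proof (rule inj_onI)
  fix i j assume i: "i \<in> {1..n}" and j: "j \<in> {1..n}" and "key n m i = key n m j"
  then have "(n * lookup m i + (n - i)) mod n = (n * lookup m j + (n - j)) mod n"
    by (simp add: key_def)
  moreover have "n - i < n" "n - j < n" using i j by auto
  ultimately show "i = j" using i j by auto
qed

section \<open>Exponents of Garsia-Stanton monomials\<close>

definition desc_from :: "nat \<Rightarrow> (nat \<Rightarrow> nat) \<Rightarrow> nat \<Rightarrow> nat" where
  "desc_from n \<pi> j = card {i \<in> Des n \<pi>. j \<le> i}"

lemma finite_Des: "finite (Des n \<pi>)"
  by (rule finite_subset[of _ "{1..n}"]) (auto simp: Des_def)

lemma desc_from_Suc:
  "desc_from n \<pi> j = desc_from n \<pi> (Suc j) + (if j \<in> Des n \<pi> then 1 else 0)"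
proof -
  have "{i \<in> Des n \<pi>. j \<le> i}
      = (if j \<in> Des n \<pi> then insert j {i \<in> Des n \<pi>. Suc j \<le> i} else {i \<in> Des n \<pi>. Suc j \<le> i})"
    by (auto simp: Suc_le_eq le_less)
  then show ?thesis using finite_Des[of n \<pi>] by (auto simp: desc_from_def)
qed

lemma desc_from_n: "1 \<le> n \<Longrightarrow> desc_from n \<pi> n = 0"
  by (auto simp: desc_from_def Des_def finite_Des)

lemma desc_from_1: "desc_from n \<pi> 1 = des n \<pi>"
  unfolding desc_from_def des_def by (rule arg_cong[of _ _ card]) (auto simp: Des_def)

lemma mon_eq_prod:
  assumes "m \<in> expos n"
  shows "mon m = (\<Prod>i\<in>{1..n}. X i ^ lookup m i)"
proof -
  have m: "m = (\<Sum>i\<in>{1..n}. Poly_Mapping.single i (lookup m i))"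
    using assms
    by (intro poly_mapping_eqI) (auto simp: lookup_sum lookup_single when_def expos_def in_keys_iff)
  have "mon (\<Sum>i\<in>A. Poly_Mapping.single i (lookup m i)) = (\<Prod>i\<in>A. X i ^ lookup m i)"
    if "finite A" for A
    using that by (induction A rule: finite_induct) (simp_all add: X_power_eq flip: mon_mult)
  then show ?thesis by (subst m) simp
qed

text \<open>\<open>X (\<pi> j)\<close> occurs once for every descent at position \<open>j\<close> or
  later; interchange the two products.\<close>

lemma gs_eq_prod: "gs n \<pi> = (\<Prod>j\<in>{1..n}. X (\<pi> j) ^ desc_from n \<pi> j)"
proof -
  have "gs n \<pi> = (\<Prod>i\<in>Des n \<pi>. \<Prod>j\<in>{1..n}. if j \<le> i then X (\<pi> j) else 1)"
    unfolding gs_def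
  proof (rule prod.cong[OF refl])
    fix i assume "i \<in> Des n \<pi>"
    then have "{j \<in> {1..n}. j \<le> i} = {1..i}" by (auto simp: Des_def)
    then show "(\<Prod>j\<in>{1..i}. X (\<pi> j)) = (\<Prod>j\<in>{1..n}. if j \<le> i then X (\<pi> j) else 1)"
      using prod.inter_filter[of "{1..n}" "\<lambda>j. X (\<pi> j)" "\<lambda>j. j \<le> i"] by simp
  qed
  also have "\<dots> = (\<Prod>j\<in>{1..n}. \<Prod>i\<in>Des n \<pi>. if j \<le> i then X (\<pi> j) else 1)"
    by (rule prod.swap)
  also have "\<dots> = (\<Prod>j\<in>{1..n}. X (\<pi> j) ^ desc_from n \<pi> j)"
    unfolding prod.inter_filter[OF finite_Des, symmetric] by (simp add: desc_from_def)
  finally show ?thesis .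
qed

lemma mon_in_GS:
  assumes \<pi>: "\<pi> permutes {1..n}" and "m \<in> expos n" and "des n \<pi> < k"
    and a: "\<forall>j\<in>{1..n - k}. a j < k - des n \<pi>" "antimono_on {1..n - k} a"
    and m: "\<And>j. j \<in> {1..n} \<Longrightarrow> lookup m (\<pi> j) = desc_from n \<pi> j + (if j \<le> n - k then a j else 0)"
  shows "mon m \<in> GS n k"
proof -
  have "mon m = (\<Prod>i\<in>{1..n}. X i ^ lookup m i)"
    using assms(2) by (rule mon_eq_prod)
  also have "\<dots> = (\<Prod>j\<in>{1..n}. X (\<pi> j) ^ lookup m (\<pi> j))"
    using prod.permute[OF \<pi>, of "\<lambda>i. X i ^ lookup m i"] by (simp add: o_def)
  also have "\<dots> = (\<Prod>j\<in>{1..n}. X (\<pi> j) ^ desc_from n \<pi> j * (if j \<le> n - k then X (\<pi> j) ^ a j else 1))"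
    by (intro prod.cong refl) (simp add: m power_add)
  also have "\<dots> = gs n \<pi> * (\<Prod>j\<in>{1..n}. if j \<le> n - k then X (\<pi> j) ^ a j else 1)"
    by (simp add: prod.distrib gs_eq_prod)
  also have "(\<Prod>j\<in>{1..n}. if j \<le> n - k then X (\<pi> j) ^ a j else 1) = (\<Prod>j\<in>{1..n - k}. X (\<pi> j) ^ a j)"
    by (subst prod.inter_filter[symmetric]) (auto intro!: prod.cong)
  finally show ?thesis
    unfolding GS_def using assms by blast
qed

lemma mon_image_mult: "p \<in> mon ` expos n \<Longrightarrow> q \<in> mon ` expos n \<Longrightarrow> p * q \<in> mon ` expos n"
  using expos_add by (auto simp: mon_mult)

lemma mon_image_prod: "(\<And>i. i \<in> A \<Longrightarrow> f i \<in> mon ` expos n) \<Longrightarrow> prod f A \<in> mon ` expos n"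
proof (induction A rule: infinite_finite_induct)
  case (insert i A)
  then show ?case by (simp add: mon_image_mult)
qed (auto intro: image_eqI[of _ _ 0] simp: expos_def)

lemma GS_subset_mon: "k \<le> n \<Longrightarrow> GS n k \<subseteq> mon ` expos n"
proof
  fix p assume "k \<le> n" "p \<in> GS n k"
  then obtain \<pi> a where \<pi>: "\<pi> permutes {1..n}"
    and p: "p = gs n \<pi> * (\<Prod>j\<in>{1..n - k}. X (\<pi> j) ^ a j)"
    unfolding GS_def by blast
  have X: "X (\<pi> j) ^ e \<in> mon ` expos n" if "j \<in> {1..n}" for j e
    unfolding X_power_eq using permutes_in_image[OF \<pi>, of j] that
    by (intro imageI) (auto simp: expos_def)
  show "p \<in> mon ` expos n"
    unfolding p gs_eq_prod by (intro mon_image_mult mon_image_prod X) auto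
qed

text \<open>Sort by \<open>key\<close> and write the exponents as those of \<open>gs n \<pi>\<close>
  plus a weakly decreasing \<open>b\<close>. If no exponent reaches \<open>k\<close> and
  \<open>b\<close> is zero beyond position \<open>n - k\<close>, the monomial lies in
  \<open>GS n k\<close>. If \<open>b\<close> is nonzero there, it is positive on an initial segment
  of length \<open>e > n - k\<close>; dividing by the variables \<open>T\<close> at these positions
  leaves \<open>T\<close> with the \<open>e\<close> largest keys, so multiplying by \<open>T\<close>
  raises the potential more than any other \<open>e\<close>-subset does.\<close>

lemma straightening_cases:
  assumes "1 \<le> k" "k \<le> n" and m: "m \<in> expos n"
  obtains
    (power) i where "i \<in> {1..n}" "lookup m i \<ge> k"
  | (GS) "mon m \<in> GS n k"
  | (elem_sym) d T m' where "d \<in> {n - k + 1..n}" "T \<subseteq> {1..n}" "card T = d" "m' \<in> expos n"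
      "m = m' + indic T"
      "\<And>S. S \<subseteq> {1..n} \<Longrightarrow> card S = d \<Longrightarrow> S \<noteq> T \<Longrightarrow> potential n (m' + indic S) < potential n m"
proof -
  obtain \<pi> where \<pi>: "\<pi> permutes {1..n}"
    and sorted: "\<And>i j. 1 \<le> i \<Longrightarrow> i < j \<Longrightarrow> j \<le> n \<Longrightarrow> key n m (\<pi> i) > key n m (\<pi> j)"
    using ex_permutes_sorting_decreasing[OF inj_on_key] by blast
  have \<pi>_in: "1 \<le> \<pi> j \<and> \<pi> j \<le> n" if "1 \<le> j" "j \<le> n" for j
    using permutes_in_image[OF \<pi>, of j] that by simp
  define a where "a j = lookup m (\<pi> j)" for j
  define d where "d = desc_from n \<pi>"
  have a_step: "a (Suc j) + d j \<le> a j + d (Suc j)" if j: "1 \<le> j" "j < n" for j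
  proof -
    have key: "n * a (Suc j) + (n - \<pi> (Suc j)) < n * a j + (n - \<pi> j)"
      using sorted[of j "Suc j"] j by (simp add: key_def a_def)
    have "n - \<pi> j < n" using \<pi>_in[of j] j by simp
    with key have "n * a (Suc j) < n * (a j + 1)" unfolding distrib_left by linarith
    then have le: "a (Suc j) \<le> a j" by (simp only: mult_less_cancel1) simp
    \<comment> \<open>Equal exponents are ordered by increasing index, so a descent of
      \<open>\<pi>\<close> forces a strict drop.\<close>
    have "a (Suc j) < a j" if "j \<in> Des n \<pi>"
    proof (rule ccontr)
      assume "\<not> a (Suc j) < a j"
      then have "a (Suc j) = a j" using le by simp
      then have "\<pi> j < \<pi> (Suc j)" using key by simp
      then show False using that by (simp add: Des_def)
    qed
    then show ?thesis using le desc_from_Suc[of n \<pi> j] by (auto simp: d_def)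
  qed
  \<comment> \<open>This says that \<open>a - d\<close> is weakly decreasing, in a form without
    truncated subtraction.\<close>
  have mono: "a j + d i \<le> a i + d j" if "1 \<le> i" "i \<le> j" "j \<le> n" for i j
    using that(2,1,3)
  proof (induction j rule: dec_induct)
    case (step l)
    then show ?case using a_step[of l] by simp
  qed simp
  have da: "d j \<le> a j" if "1 \<le> j" "j \<le> n" for j
    using mono[of j n] that desc_from_n[of n \<pi>] by (simp add: d_def)
  define b where "b j = a j - d j" for j
  have ab: "a j = d j + b j" if "1 \<le> j" "j \<le> n" for j
    using da[OF that] by (simp add: b_def)
  have b_anti: "b j \<le> b i" if "1 \<le> i" "i \<le> j" "j \<le> n" for i j
    using mono[OF that] ab[of i] ab[of j] that by simp
  have d1: "d 1 = des n \<pi>" unfolding d_def by (rule desc_from_1)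
  show ?thesis
  proof (cases "a 1 \<ge> k")
    case True
    then show ?thesis using power[of "\<pi> 1"] \<pi>_in[of 1] assms by (simp add: a_def)
  next
    case False
    show ?thesis
    proof (cases "\<forall>j\<in>{n - k + 1..n}. b j = 0")
      case True
      have "mon m \<in> GS n k"
      proof (rule mon_in_GS[OF \<pi> m, where a = b])
        show "des n \<pi> < k" using False da[of 1] d1 assms by simp
        \<comment> \<open>\<open>d 1\<close> counts all descents, so \<open>a 1 < k\<close> turns
          into the strict bound on \<open>b 1\<close>.\<close>
        have "b 1 < k - des n \<pi>" using False ab[of 1] d1 assms by simp
        moreover have "b j \<le> b 1" if "j \<in> {1..n - k}" for j
          using that by (intro b_anti) auto
        ultimately show "\<forall>j\<in>{1..n - k}. b j < k - des n \<pi>"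
          using le_less_trans by blast
        show "antimono_on {1..n - k} b"
          using b_anti by (auto simp: monotone_on_def)
        fix j assume "j \<in> {1..n}"
        then show "lookup m (\<pi> j) = desc_from n \<pi> j + (if j \<le> n - k then b j else 0)"
          using ab[of j] True by (auto simp: a_def d_def)
      qed
      then show ?thesis by (rule GS)
    next
      case nz: False
      define J where "J = {j \<in> {1..n}. b j \<noteq> 0}"
      \<comment> \<open>\<open>b\<close> is weakly decreasing, so its support is
        \<open>{1..e}\<close>; the nonzero value beyond \<open>n - k\<close> gives
        \<open>e \<ge> n - k + 1\<close>.\<close>
      define e where "e = Max J"
      have "finite J" by (simp add: J_def)
      obtain l where l: "l \<in> {n - k + 1..n}" "b l \<noteq> 0" using nz by blast
      then have "l \<in> J" by (simp add: J_def)
      then have "e \<in> J" "l \<le> e"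
        unfolding e_def using Max_in[OF \<open>finite J\<close>] Max_ge[OF \<open>finite J\<close>] by blast+
      then have J: "e \<in> J" "n - k + 1 \<le> e" using l by auto
      have pos: "b j \<noteq> 0" if "1 \<le> j" "j \<le> e" for j
        using b_anti[of j e] J that by (auto simp: J_def)
      have zero: "b j = 0" if "e < j" "j \<le> n" for j
      proof (rule ccontr)
        assume "b j \<noteq> 0"
        then have "j \<in> J" using that by (simp add: J_def)
        then show False using Max_ge[OF \<open>finite J\<close>, of j] that by (simp add: e_def)
      qed
      have e: "1 \<le> e" "e \<le> n" using J by (auto simp: J_def)
      define T where "T = \<pi> ` {1..e}"
      have T: "T \<subseteq> {1..n}" using \<pi>_in e by (auto simp: T_def)
      have cT: "card T = e"
        unfolding T_def by (subst card_image) (auto intro: inj_on_subset[OF permutes_inj[OF \<pi>]])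
      have fT: "finite T" by (simp add: T_def)
      \<comment> \<open>This subtraction does not truncate: by \<open>a_T\<close> every exponent on
        \<open>T\<close> is at least 1.\<close>
      define m' where "m' = m - indic T"
      have m'_lookup: "lookup m' i = lookup m i - (if i \<in> T then 1 else 0)" for i
        by (simp add: m'_def lookup_minus lookup_indic[OF fT])
      have a_T: "lookup m i \<ge> 1" if "i \<in> T" for i
        using that pos ab e by (force simp: T_def a_def)
      have mm': "m = m' + indic T"
        by (rule poly_mapping_eqI) (use a_T in \<open>auto simp: lookup_add m'_lookup lookup_indic[OF fT]\<close>)
      have m'_expos: "m' \<in> expos n"
        using m by (auto simp: expos_def in_keys_iff m'_lookup)
      \<comment> \<open>The exponents of \<open>gs n \<pi>\<close> alone are already sorted by
        \<open>\<pi>\<close> for this key. The sign turns the decreasing sequence into an increasing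
        one.\<close>
      have dec: "strict_mono_on {1..n} (\<lambda>j. - int (n * d j + (n - \<pi> j)))"
      proof (rule strict_mono_on_SucI)
        fix j assume j: "1 \<le> j" "j < n"
        have "\<pi> j \<noteq> \<pi> (Suc j)" using inj_eq[OF permutes_inj[OF \<pi>], of j "Suc j"] by simp
        then have "j \<notin> Des n \<pi> \<Longrightarrow> \<pi> j < \<pi> (Suc j)" using j by (auto simp: Des_def)
        moreover have "d j = d (Suc j) + (if j \<in> Des n \<pi> then 1 else 0)"
          unfolding d_def by (rule desc_from_Suc)
        ultimately have "n * d (Suc j) + (n - \<pi> (Suc j)) < n * d j + (n - \<pi> j)"
          using \<pi>_in[of j] \<pi>_in[of "Suc j"] j by (auto simp: algebra_simps split: if_splits)
        then show "- int (n * d j + (n - \<pi> j)) < - int (n * d (Suc j) + (n - \<pi> (Suc j)))"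
          by linarith
      qed
      \<comment> \<open>In \<open>m'\<close> the variables outside \<open>T\<close> have exponent
        exactly \<open>d\<close> and those in \<open>T\<close> at least \<open>d\<close>, so the
        comparison reduces to \<open>dec\<close>.\<close>
      have top: "key n m' j < key n m' i" if i: "i \<in> T" and j: "j \<in> {1..n} - T" for i j
      proof -
        obtain p where p: "i = \<pi> p" "1 \<le> p" "p \<le> e" using i by (auto simp: T_def)
        have "j \<in> \<pi> ` {1..n}" unfolding permutes_image[OF \<pi>] using j by blast
        then obtain q where q: "j = \<pi> q" "1 \<le> q" "q \<le> n" by auto
        have "e < q"
        proof (rule ccontr)
          assume "\<not> e < q"
          then have "j \<in> T" using q by (simp add: T_def)
          then show False using j by blast
        qed
        have "- int (n * d p + (n - \<pi> p)) < - int (n * d q + (n - \<pi> q))"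
          by (rule strict_mono_onD[OF dec]) (use p q e \<open>e < q\<close> in auto)
        then have "n * d q + (n - \<pi> q) < n * d p + (n - \<pi> p)"
          by (simp only: neg_less_iff_less of_nat_less_iff)
        moreover have "lookup m' (\<pi> q) = d q"
          using j zero[of q] ab[of q] q \<open>e < q\<close> by (simp add: m'_lookup a_def)
        then have "n * lookup m' (\<pi> q) = n * d q" by simp
        moreover have "d p \<le> lookup m' (\<pi> p)"
          using i pos[of p] ab[of p] p e by (simp add: m'_lookup a_def)
        then have "n * d p \<le> n * lookup m' (\<pi> p)" by simp
        ultimately show ?thesis unfolding key_def p(1) q(1) by linarith
      qed
      show ?thesis
      proof (rule elem_sym[OF _ T cT m'_expos mm'])
        show "e \<in> {n - k + 1..n}" using J e by simp
        fix S assume S: "S \<subseteq> {1..n}" "card S = e" "S \<noteq> T"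
        then have "sum (key n m') S < sum (key n m') T"
          using cT fT finite_subset[OF S(1)] by (intro sum_less_sum_top top) auto
        then show "potential n (m' + indic S) < potential n m"
          unfolding mm' potential_add_indic[OF S(1)] potential_add_indic[OF T] using S(2) cT by simp
      qed
    qed
  qed
qed

text \<open>Rewriting within one degree, by induction on the potential. \<open>U\<close> stays
  abstract because the argument is used twice: modulo the ideal, and on the words, where multiples
  of generators drop in degree.\<close>

lemma straightening:
  assumes "1 \<le> k" "k \<le> n" and U: "poly_vs.subspace U"
    and GS: "\<And>m. m \<in> expos n \<Longrightarrow> tdeg n m = D \<Longrightarrow> mon m \<in> GS n k \<Longrightarrow> mon m \<in> U"
    and power: "\<And>m i. m \<in> expos n \<Longrightarrow> i \<in> {1..n} \<Longrightarrow> tdeg n m + k = D \<Longrightarrow> mon m * X i ^ k \<in> U"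
    and elem_sym: "\<And>m d. m \<in> expos n \<Longrightarrow> d \<in> {n - k + 1..n} \<Longrightarrow> tdeg n m + d = D \<Longrightarrow>
      mon m * elem_sym n d \<in> U"
    and "m \<in> expos n" "tdeg n m = D"
  shows "mon m \<in> U"
  using assms(7,8)
proof (induction "potential n m" arbitrary: m rule: less_induct)
  case less
  from assms(1,2) less.prems(1) show ?case
  proof (cases rule: straightening_cases)
    case (power i)
    define m' where "m' = m - Poly_Mapping.single i k"
    have l: "lookup m' j = lookup m j - (if j = i then k else 0)" for j
      by (simp add: m'_def lookup_minus lookup_single when_def)
    have m: "m = m' + Poly_Mapping.single i k"
      by (rule poly_mapping_eqI) (use power in \<open>auto simp: lookup_add l lookup_single when_def\<close>)
    have "m' \<in> expos n"
      using less.prems(1) by (auto simp: expos_def in_keys_iff l)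
    moreover have "tdeg n (Poly_Mapping.single i k) = k"
      using power(1) by (simp add: tdeg_def lookup_single when_def)
    then have "tdeg n m' + k = D" using less.prems(2) unfolding m tdeg_add by simp
    ultimately have "mon m' * X i ^ k \<in> U" using assms(5) power(1) by blast
    then show ?thesis unfolding X_power_eq mon_mult m[symmetric] .
  next
    case GS
    then show ?thesis using less.prems assms(4) by blast
  next
    case (elem_sym d T m')
    let ?Ss = "{S. S \<subseteq> {1..n} \<and> card S = d}"
    have fin: "finite ?Ss" by simp
    have deg: "tdeg n m' + d = D"
      using less.prems(2) elem_sym(2,3) unfolding elem_sym(5) tdeg_add by (simp add: tdeg_indic)
    have "mon m' * elem_sym n d = (\<Sum>S\<in>?Ss. mon (m' + indic S))"
      by (simp add: elem_sym_eq sum_distrib_left mon_mult)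
    also have "\<dots> = mon m + (\<Sum>S\<in>?Ss - {T}. mon (m' + indic S))"
      using elem_sym(2,3,5) by (subst sum.remove[OF fin, of T]) auto
    \<comment> \<open>Every remaining term has degree \<open>D\<close> and smaller potential, so the
      induction hypothesis covers it.\<close>
    finally have "mon m = mon m' * elem_sym n d - (\<Sum>S\<in>?Ss - {T}. mon (m' + indic S))"
      by simp
    moreover have "mon (m' + indic S) \<in> U" if "S \<in> ?Ss - {T}" for S
    proof (rule less.hyps)
      show "potential n (m' + indic S) < potential n m" using that elem_sym(6) by blast
      show "m' + indic S \<in> expos n" using that elem_sym(4) by (intro expos_add indic_expos) auto
      show "tdeg n (m' + indic S) = D" using that deg by (auto simp: tdeg_add tdeg_indic)
    qed
    then have "(\<Sum>S\<in>?Ss - {T}. mon (m' + indic S)) \<in> U"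
      by (rule poly_vs.subspace_sum[OF U])
    moreover have "mon m' * elem_sym n d \<in> U"
      using assms(6) elem_sym(1,4) deg by blast
    ultimately show ?thesis using poly_vs.subspace_diff[OF U] by simp
  qed
qed

section \<open>Independence and spanning\<close>

lemma mon_eq_iff: "mon m = mon m' \<longleftrightarrow> m = m'"
proof
  assume "mon m = mon m'"
  then have "lookup (mon m) m = lookup (mon m') m" by (rule arg_cong)
  then show "m = m'" by (simp add: lookup_single when_def split: if_splits)
qed simp

text \<open>Induction on the degree. Multiples of generators in degree \<open>D\<close> agree on the
  words with polynomials of degree below \<open>D\<close>, which the induction hypothesis handles;
  straightening then leaves only monomials of \<open>GS n k\<close> in degree
  \<open>D\<close>.\<close>

lemma lowv_subset_GS:
  assumes "1 \<le> k" "k \<le> n"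
  shows "lowv n k D \<subseteq> {p + q |p q. p \<in> poly_vs.span {mon m |m. mon m \<in> GS n k \<and> tdeg n m < D} \<and> q \<in> vanishing n k}"
proof (induction D)
  case 0
  show ?case unfolding lowv_def low_def by auto
next
  case (Suc D)
  let ?U = "\<lambda>D. {p + q |p q. p \<in> poly_vs.span {mon m |m. mon m \<in> GS n k \<and> tdeg n m < D} \<and> q \<in> vanishing n k}"
  have U: "poly_vs.subspace (?U (Suc D))"
    by (intro poly_vs.subspace_sums subspace_vanishing poly_vs.subspace_span)
  have "poly_vs.span {mon m |m. mon m \<in> GS n k \<and> tdeg n m < D}
      \<subseteq> poly_vs.span {mon m |m. mon m \<in> GS n k \<and> tdeg n m < Suc D}"
    by (rule poly_vs.span_mono) auto
  then have "?U D \<subseteq> ?U (Suc D)" by blast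
  with Suc.IH have IH: "lowv n k D \<subseteq> ?U (Suc D)" by (rule subset_trans)
  have span_U: "p \<in> ?U (Suc D)" if "p \<in> poly_vs.span {mon m |m. mon m \<in> GS n k \<and> tdeg n m < Suc D}" for p
    using that poly_vs.subspace_0[OF subspace_vanishing[of n k]] by force
  have van_U: "p \<in> ?U (Suc D)" if "p \<in> vanishing n k" for p
    using that poly_vs.span_zero by force
  have top: "mon m \<in> ?U (Suc D)" if "m \<in> expos n" "tdeg n m = D" for m
  proof (rule straightening[OF assms U _ _ _ that])
    fix m assume "mon m \<in> GS n k" "tdeg n m = D"
    then show "mon m \<in> ?U (Suc D)"
      by (intro span_U poly_vs.span_base) auto
  next
    fix m i assume "m \<in> expos n" "i \<in> {1..n}" "tdeg n m + k = D"
    then show "mon m * X i ^ k \<in> ?U (Suc D)"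
      using mon_mult_lowv[OF _ X_power_in_lowv] IH by blast
  next
    fix m d assume "m \<in> expos n" "d \<in> {n - k + 1..n}" "tdeg n m + d = D"
    then show "mon m * elem_sym n d \<in> ?U (Suc D)"
      using mon_mult_lowv[OF _ elem_sym_in_lowv[OF _ assms(2)]] IH by blast
  qed
  have "low n (Suc D) \<subseteq> ?U (Suc D)"
    unfolding low_def
  proof (rule poly_vs.span_minimal[OF _ U], rule subsetI)
    fix p assume "p \<in> {mon m |m. m \<in> expos n \<and> tdeg n m < Suc D}"
    then obtain m where m: "m \<in> expos n" "tdeg n m < Suc D" and p: "p = mon m" by blast
    have "mon m \<in> ?U (Suc D)"
    proof (cases "tdeg n m = D")
      case True
      then show ?thesis using top m by blast
    next
      case False
      then have "mon m \<in> low n D" using m by (intro mon_in_low) auto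
      then show ?thesis using low_subset_lowv IH by blast
    qed
    then show "p \<in> ?U (Suc D)" unfolding p .
  qed
  show ?case
  proof
    fix p assume "p \<in> lowv n k (Suc D)"
    then obtain h z where "h \<in> low n (Suc D)" "z \<in> vanishing n k" and p: "p = h + z"
      unfolding lowv_def by blast
    with \<open>low n (Suc D) \<subseteq> ?U (Suc D)\<close> van_U show "p \<in> ?U (Suc D)"
      unfolding p by (intro poly_vs.subspace_add[OF U]) blast+
  qed
qed

lemma carrier_induct [consumes 1, case_names zero mon scale add]:
  assumes "p \<in> poly_carrier n" and "P 0" and "\<And>m. m \<in> expos n \<Longrightarrow> P (mon m)"
    and "\<And>c f. P f \<Longrightarrow> P (scl c f)" and "\<And>f g. P f \<Longrightarrow> P g \<Longrightarrow> P (f + g)"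
  shows "P p"
proof (induction p rule: rpoly_induct)
  case (single m c)
  then have "m \<in> expos n" using assms(1) by (simp add: poly_carrier_def expos_def)
  then have "P (scl c (mon m))" by (intro assms)
  then show ?case by (simp add: const_poly_times_single)
qed (use assms in auto)

lemma carrier_in_low:
  assumes "p \<in> poly_carrier n"
  shows "\<exists>D. p \<in> low n D"
  using assms
proof (induction p rule: carrier_induct)
  case zero
  then show ?case unfolding low_def using poly_vs.span_zero by blast
next
  case (mon m)
  then show ?case using mon_in_low by blast
next
  case (scale c f)
  then show ?case unfolding low_def using poly_vs.span_scale by blast
next
  case (add f g)
  then obtain D D' where "f \<in> low n D" "g \<in> low n D'" by blast
  then have "f \<in> low n (max D D')" "g \<in> low n (max D D')"
    using low_mono[of D "max D D'" n] low_mono[of D' "max D D'" n] by auto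
  then show ?case unfolding low_def using poly_vs.span_add by blast
qed

section \<open>Functions on the surjective words\<close>

interpretation fun_vs: vector_space "\<lambda>(c::rat) (f::(nat \<Rightarrow> nat) \<Rightarrow> rat) y. c * f y"
  by unfold_locales (auto simp: fun_eq_iff algebra_simps)

text \<open>Extension by zero places the functions on the words inside one function space; the
  kernel of \<open>restr n k\<close> is \<open>vanishing n k\<close>.\<close>

definition restr :: "nat \<Rightarrow> nat \<Rightarrow> rpoly \<Rightarrow> (nat \<Rightarrow> nat) \<Rightarrow> rat" where
  "restr n k p = (\<lambda>y. if y \<in> surj_words n k then peval n y p else 0)"

lemma restr_add: "restr n k (p + q) = restr n k p + restr n k q"
  by (auto simp: restr_def peval_add)

lemma restr_scl: "restr n k (scl c p) = (\<lambda>y. c * restr n k p y)"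
  by (auto simp: restr_def peval_mult)

lemma restr_0: "restr n k 0 = 0"
  by (auto simp: restr_def)

lemma restr_sum: "restr n k (\<Sum>i\<in>A. f i) = (\<Sum>i\<in>A. restr n k (f i))"
  by (induction A rule: infinite_finite_induct) (simp_all add: restr_0 restr_add)

lemma restr_vanishing: "restr n k p = 0 \<longleftrightarrow> p \<in> vanishing n k"
  by (auto simp: restr_def vanishing_def fun_eq_iff)

definition point_fun :: "'a \<Rightarrow> 'a \<Rightarrow> rat" where
  "point_fun y = (\<lambda>z. if z = y then 1 else 0)"

text \<open>Lagrange interpolation on a grid: the factor at position \<open>i\<close> is 1 at the
  letter \<open>y i\<close> and 0 at every other letter.\<close>

lemma point_fun_lagrange:
  assumes y: "y \<in> surj_words n k"
  obtains p where "p \<in> poly_carrier n" "restr n k p = point_fun y"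
proof -
  let ?f = "\<lambda>i j. scl (inverse (of_nat (y i) - of_nat j)) (X i - const_poly (of_nat j))"
  define p where "p = (\<Prod>i\<in>{1..n}. \<Prod>j\<in>{1..k} - {y i}. ?f i j)"
  have minus: "f - g \<in> poly_carrier n" if "f \<in> poly_carrier n" "g \<in> poly_carrier n" for f g :: rpoly
    using that keys_diff[of f g] unfolding poly_carrier_def by blast
  have mult: "f * g \<in> poly_carrier n" if "f \<in> poly_carrier n" "g \<in> poly_carrier n" for f g
    using subcringE(6)[OF subcring_poly_carrier[of n]] that by simp
  have "p \<in> poly_carrier n"
    unfolding p_def
    by (intro prod_in_poly_carrier mult minus X_in_carrier const_poly_in_carrier)
  moreover have "restr n k p z = point_fun y z" for z
  proof (cases "z \<in> surj_words n k")
    case False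
    then show ?thesis using y by (auto simp: restr_def point_fun_def)
  next
    case z: True
    have ev: "peval n z p = (\<Prod>i\<in>{1..n}. \<Prod>j\<in>{1..k} - {y i}.
        inverse (of_nat (y i) - of_nat j) * (of_nat (z i) - of_nat j))"
      unfolding p_def peval_prod by (intro prod.cong refl) (simp add: peval_mult peval_minus peval_X)
    show ?thesis
    proof (cases "z = y")
      case True
      have "peval n z p = 1"
        unfolding ev by (intro prod.neutral ballI) (auto simp: True)
      then show ?thesis using z True by (simp add: restr_def point_fun_def)
    next
      case False
      have "\<exists>i\<in>{1..n}. z i \<noteq> y i"
      proof (rule ccontr)
        assume "\<not> ?thesis"
        then have "z = y"
          using y z unfolding surj_words_def by (intro PiE_ext[of z _ _ y]) auto
        with False show False by simp
      qed
      then obtain i where i: "i \<in> {1..n}" "z i \<noteq> y i" by blast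
      have "z i \<in> {1..k}" using z i by (auto simp: surj_words_def)
      then have "(\<Prod>j\<in>{1..k} - {y i}. inverse (of_nat (y i) - of_nat j) * (of_nat (z i) - of_nat j)) = (0::rat)"
        using i by (intro prod_zero) auto
      then have "peval n z p = 0"
        unfolding ev using i by (intro prod_zero) auto
      then show ?thesis using z False by (simp add: restr_def point_fun_def)
    qed
  qed
  ultimately show ?thesis using that by blast
qed

lemma inj_point_fun: "inj point_fun"
proof (rule injI)
  fix x y :: 'a assume "point_fun x = point_fun y"
  then have "point_fun x x = point_fun y x" by simp
  then show "x = y" by (simp add: point_fun_def split: if_splits)
qed

lemma independent_point_fun: "\<not> fun_vs.dependent (point_fun ` A)"
proof -
  have "(\<forall>v\<in>S. u v = 0)" if S: "S \<subseteq> point_fun ` A" "finite S"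
    and z: "(\<Sum>v\<in>S. (\<lambda>y. u v * v y)) = 0" for S u
  proof
    fix v assume v: "v \<in> S"
    then obtain y where y: "v = point_fun y" using S by blast
    have "0 = (\<Sum>w\<in>S. (\<lambda>y. u w * w y)) y" by (simp add: z)
    also have "\<dots> = (\<Sum>w\<in>S. u w * w y)" by (induction S rule: infinite_finite_induct) simp_all
    also have "\<dots> = (\<Sum>w\<in>S. if w = v then u w else 0)"
    proof (rule sum.cong[OF refl])
      fix w assume "w \<in> S"
      then obtain x where x: "w = point_fun x" using S by blast
      have "w = v \<longleftrightarrow> x = y" unfolding x y using inj_point_fun by (auto dest: injD)
      then show "u w * w y = (if w = v then u w else 0)" by (auto simp: x point_fun_def)
    qed
    also have "\<dots> = u v" using S v by simp
    finally show "u v = 0" by simp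
  qed
  then show ?thesis unfolding fun_vs.independent_explicit_finite_subsets by blast
qed

text \<open>\<open>GS n k\<close> spans the functions on the words, a space of dimension
  \<open>card (surj_words n k)\<close>, and has no more elements than that; a spanning set of such
  size is independent.\<close>

lemma GS_independent_on_surj_words:
  assumes "1 \<le> k" "k \<le> n"
    and van: "(\<Sum>p\<in>GS n k. scl (c p) p) \<in> vanishing n k" and "p \<in> GS n k"
  shows "c p = 0"
proof -
  let ?r = "restr n k"
  let ?B = "point_fun ` surj_words n k"
  have "?r q \<in> fun_vs.span (?r ` GS n k)" if "q \<in> poly_vs.span (GS n k)" for q
    using that
  proof (induction q rule: poly_vs.span_induct_alt)
    case base
    show ?case unfolding restr_0 by (rule fun_vs.span_zero)
  next
    case (step a x y)
    then show ?case
      unfolding restr_add restr_scl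
      by (intro fun_vs.span_add[OF fun_vs.span_scale[OF fun_vs.span_base[OF imageI]]])
  qed
  note span_restr = this
  have B: "?B \<subseteq> fun_vs.span (?r ` GS n k)"
  proof (rule image_subsetI)
    fix y assume "y \<in> surj_words n k"
    then obtain q where q: "q \<in> poly_carrier n" "?r q = point_fun y"
      using point_fun_lagrange by blast
    obtain D where "q \<in> low n D" using carrier_in_low q by blast
    then obtain f z where f: "f \<in> poly_vs.span {mon m |m. mon m \<in> GS n k \<and> tdeg n m < D}"
      and z: "z \<in> vanishing n k" and "q = f + z"
      using lowv_subset_GS[OF assms(1,2), of D] low_subset_lowv[of n D k] by blast
    then have "point_fun y = ?r f" using q by (simp add: restr_add flip: restr_vanishing)
    moreover have "f \<in> poly_vs.span (GS n k)"
      using f poly_vs.span_mono[of "{mon m |m. mon m \<in> GS n k \<and> tdeg n m < D}" "GS n k"] by blast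
    ultimately show "point_fun y \<in> fun_vs.span (?r ` GS n k)" using span_restr by simp
  qed
  have fin: "finite (GS n k)" and le: "card (GS n k) \<le> card ?B"
    using card_GS_le[OF assms(1,2)] card_image[OF inj_on_subset[OF inj_point_fun subset_UNIV], of "surj_words n k"]
    by simp_all
  have bound: "card ?B \<le> card T" if "finite T" "?B \<subseteq> fun_vs.span T" for T
    using fun_vs.independent_span_bound[OF that(1) independent_point_fun that(2)] by blast
  \<comment> \<open>Restriction can only merge monomials, yet a spanning set has at least
    \<open>card ?B\<close> elements, so no two monomials are merged.\<close>
  have eq: "card (?r ` GS n k) = card (GS n k)"
    using bound[OF _ B] fin le card_image_le[OF fin, of ?r] by simp
  then have inj: "inj_on ?r (GS n k)" using fin by (rule eq_card_imp_inj_on[rotated])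
  have indep: "\<not> fun_vs.dependent (?r ` GS n k)"
  proof
    assume "fun_vs.dependent (?r ` GS n k)"
    then obtain a where a: "a \<in> ?r ` GS n k" "a \<in> fun_vs.span (?r ` GS n k - {a})"
      unfolding fun_vs.dependent_def by blast
    have "fun_vs.span (?r ` GS n k) = fun_vs.span (?r ` GS n k - {a})"
      using fun_vs.span_redundant[OF a(2)] a(1) by (simp add: insert_absorb)
    then have "card ?B \<le> card (?r ` GS n k - {a})"
      using B fin by (intro bound) auto
    also have "\<dots> < card (?r ` GS n k)" using a fin by (intro card_Diff1_less) auto
    finally show False using eq le by simp
  qed
  have "(\<Sum>v\<in>?r ` GS n k. (\<lambda>y. c (inv_into (GS n k) ?r v) * v y))
      = (\<Sum>q\<in>GS n k. (\<lambda>y. c q * ?r q y))"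
    using inj by (simp add: sum.reindex)
  also have "\<dots> = ?r (\<Sum>q\<in>GS n k. scl (c q) q)"
    by (simp only: restr_sum restr_scl)
  also have "\<dots> = 0" using van by (simp add: restr_vanishing)
  finally have zero: "(\<Sum>v\<in>?r ` GS n k. (\<lambda>y. c (inv_into (GS n k) ?r v) * v y)) = 0" .
  have "c (inv_into (GS n k) ?r (?r p)) = 0"
    by (rule fun_vs.independentD[OF indep _ subset_refl zero]) (use fin \<open>p \<in> GS n k\<close> in auto)
  then show ?thesis using inj \<open>p \<in> GS n k\<close> by simp
qed

section \<open>Homogeneous components of the ideal\<close>

lift_definition hom_comp :: "nat \<Rightarrow> nat \<Rightarrow> rpoly \<Rightarrow> rpoly" is
  "\<lambda>n D p m. if tdeg n m = D then p m else 0"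
  by (erule rev_finite_subset) auto

lemma hom_comp_add: "hom_comp n D (p + q) = hom_comp n D p + hom_comp n D q"
  by (rule poly_mapping_eqI) (simp add: hom_comp.rep_eq lookup_add)

lemma hom_comp_0 [simp]: "hom_comp n D 0 = 0"
  by (rule poly_mapping_eqI) (simp add: hom_comp.rep_eq)

lemma hom_comp_sum: "hom_comp n D (\<Sum>i\<in>A. f i) = (\<Sum>i\<in>A. hom_comp n D (f i))"
  by (induction A rule: infinite_finite_induct) (simp_all add: hom_comp_add)

lemma hom_comp_single:
  "hom_comp n D (Poly_Mapping.single m c) = (if tdeg n m = D then Poly_Mapping.single m c else 0)"
  by (rule poly_mapping_eqI) (auto simp: hom_comp.rep_eq lookup_single when_def)

lemma hom_comp_scl: "hom_comp n D (scl c p) = scl c (hom_comp n D p)"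
  by (induction p rule: rpoly_induct)
    (simp_all add: hom_comp_add hom_comp_single const_poly_times_single distrib_left)

lemma hom_comp_mon_mult:
  "hom_comp n D (mon m * p) = (if tdeg n m \<le> D then mon m * hom_comp n (D - tdeg n m) p else 0)"
  by (induction p rule: rpoly_induct)
    (auto simp: hom_comp_add hom_comp_single mult_single tdeg_add distrib_left)

lemma hom_comp_elem_sym: "hom_comp n D (elem_sym n d) = (if d = D then elem_sym n d else 0)"
  unfolding elem_sym_eq hom_comp_sum
  by (auto simp: hom_comp_single tdeg_indic intro!: sum.cong sum.neutral)

lemma hom_comp_X_power:
  "i \<in> {1..n} \<Longrightarrow> hom_comp n D (X i ^ k) = (if k = D then X i ^ k else 0)"
  unfolding X_power_eq hom_comp_single by (simp add: tdeg_def lookup_single when_def)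

lemma poly_ring_simps:
  "monoid.mult (poly_ring n) = (*)" "add (poly_ring n) = (+)" "zero (poly_ring n) = 0"
  by (simp_all add: poly_ring_def)

text \<open>
  The generators are homogeneous, and each agrees on the surjective words with a polynomial of
  smaller degree; both properties pass to the homogeneous components of their multiples.
\<close>

lemma hom_comp_I_ideal:
  assumes "k \<le> n" "p \<in> I_ideal n k"
  shows "hom_comp n D p \<in> lowv n k D"
proof -
  \<comment> \<open>All degrees are required at once, because multiplication by a monomial moves the
    component of degree \<open>D - tdeg n m\<close> to degree \<open>D\<close>. This makes
    \<open>?J\<close> an ideal, and only the generators remain to be checked.\<close>
  let ?J = "{p \<in> poly_carrier n. \<forall>D. hom_comp n D p \<in> lowv n k D}"
  interpret P: cring "poly_ring n" by (rule cring_poly_ring)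
  note sub = poly_vs.subspace_0[OF subspace_lowv] poly_vs.subspace_add[OF subspace_lowv]
    poly_vs.subspace_scale[OF subspace_lowv]
  have carr: "f + g \<in> poly_carrier n" "f * g \<in> poly_carrier n"
    if "f \<in> poly_carrier n" "g \<in> poly_carrier n" for f g
    using P.add.m_closed P.m_closed that by (simp_all add: poly_ring_simps carrier_poly_ring)
  have closed: "hom_comp n D (x * a) \<in> lowv n k D"
    if "x \<in> poly_carrier n" and a: "\<forall>D. hom_comp n D a \<in> lowv n k D" for x a D
    using that(1)
  proof (induction x rule: carrier_induct)
    case (mon m)
    show ?case
    proof (cases "tdeg n m \<le> D")
      case True
      then show ?thesis
        using mon_mult_lowv[OF mon, of "hom_comp n (D - tdeg n m) a" k "D - tdeg n m"] a
        by (simp add: hom_comp_mon_mult)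
    qed (simp add: hom_comp_mon_mult sub)
  qed (simp_all add: sub hom_comp_add hom_comp_scl distrib_right mult.assoc)
  have "ideal ?J (poly_ring n)"
  proof (rule idealI)
    show "ring (poly_ring n)" by (rule P.ring_axioms)
    show "subgroup ?J (add_monoid (poly_ring n))"
    proof (rule P.add.subgroupI)
      show "?J \<noteq> {}" using P.zero_closed sub(1) by (auto simp: poly_ring_simps carrier_poly_ring intro!: exI[of _ 0])
      fix a assume a: "a \<in> ?J"
      have neg: "const_poly (- 1) * a = - a"
        by (simp add: const_poly_def single_uminus)
      have "const_poly (- 1) * a \<in> poly_carrier n"
        using a by (intro carr const_poly_in_carrier) blast
      moreover have "hom_comp n D (const_poly (- 1) * a) \<in> lowv n k D" for D
        using a unfolding hom_comp_scl by (intro sub) blast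
      ultimately have "const_poly (- 1) * a \<in> ?J" by blast
      then have "- a \<in> ?J" unfolding neg .
      moreover have "\<ominus>\<^bsub>poly_ring n\<^esub> a = - a"
        using a \<open>- a \<in> ?J\<close>
        by (intro P.minus_equality) (auto simp: poly_ring_simps carrier_poly_ring)
      ultimately show "\<ominus>\<^bsub>poly_ring n\<^esub> a \<in> ?J" by (simp only:)
    qed (auto simp: poly_ring_simps carrier_poly_ring carr hom_comp_add sub)
  next
    fix a x assume "a \<in> ?J" "x \<in> carrier (poly_ring n)"
    then have "x * a \<in> ?J" using closed carr by (simp add: carrier_poly_ring)
    then show "x \<otimes>\<^bsub>poly_ring n\<^esub> a \<in> ?J" "a \<otimes>\<^bsub>poly_ring n\<^esub> x \<in> ?J"
      by (simp_all add: poly_ring_simps mult.commute)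
  qed
  moreover have "{X i ^ k |i. i \<in> {1..n}} \<union> {elem_sym n d |d. d \<in> {n - k + 1..n}} \<subseteq> ?J"
  proof (intro Un_least subsetI)
    fix p assume "p \<in> {X i ^ k |i. i \<in> {1..n}}"
    then obtain i where "i \<in> {1..n}" "p = X i ^ k" by blast
    then show "p \<in> ?J"
      using X_power_in_lowv sub(1)
      by (auto simp: hom_comp_X_power intro!: power_in_poly_carrier X_in_carrier)
  next
    fix p assume "p \<in> {elem_sym n d |d. d \<in> {n - k + 1..n}}"
    then obtain d where d: "d \<in> {n - k + 1..n}" "p = elem_sym n d" by blast
    have "p \<in> poly_carrier n"
      unfolding d elem_sym_def
      by (intro sum_in_poly_carrier prod_in_poly_carrier X_in_carrier) auto
    then show "p \<in> ?J"
      using d elem_sym_in_lowv[OF _ assms(1)] sub(1) by (auto simp: hom_comp_elem_sym)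
  qed
  ultimately have "I_ideal n k \<subseteq> ?J"
    unfolding I_ideal_def by (rule P.genideal_minimal)
  then show ?thesis using assms(2) by blast
qed

text \<open>A component of the relation in degree \<open>D\<close> agrees on the words with a
  combination of monomials in \<open>GS n k\<close> of degree below \<open>D\<close>. The degrees
  keep the two apart, so their difference would be a nontrivial relation on the words.\<close>

lemma GS_independent_mod_ideal:
  assumes "1 \<le> k" "k \<le> n"
    and mem: "(\<Sum>p\<in>GS n k. scl (c p) p) \<in> I_ideal n k" and "p \<in> GS n k"
  shows "c p = 0"
proof (rule ccontr)
  assume "c p \<noteq> 0"
  have fin: "finite (GS n k)" by (rule card_GS_le[OF assms(1,2)])
  define M where "M = {m \<in> expos n. mon m \<in> GS n k}"
  have inj: "inj_on mon M" by (simp add: inj_on_def mon_eq_iff)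
  have GS: "GS n k = mon ` M"
    using GS_subset_mon[OF assms(2)] by (auto simp: M_def)
  have finM: "finite M" using fin inj unfolding GS by (simp add: finite_image_iff)
  define N where "N = {m \<in> M. c (mon m) \<noteq> 0}"
  have "N \<noteq> {}" "finite N" using \<open>c p \<noteq> 0\<close> \<open>p \<in> GS n k\<close> finM unfolding GS N_def by auto
  define D where "D = Max (tdeg n ` N)"
  obtain m0 where m0: "m0 \<in> N" "tdeg n m0 = D"
    using Max_in[of "tdeg n ` N"] \<open>N \<noteq> {}\<close> \<open>finite N\<close> unfolding D_def
    by (metis (no_types, lifting) finite_imageI image_iff image_is_empty)
  let ?f = "\<lambda>m. scl (c (mon m)) (mon m)"
  have "hom_comp n D (\<Sum>m\<in>M. ?f m) \<in> lowv n k D"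
    using hom_comp_I_ideal[OF assms(2) mem] unfolding GS by (simp add: sum.reindex[OF inj] o_def)
  then obtain g z where g: "g \<in> poly_vs.span {mon m |m. mon m \<in> GS n k \<and> tdeg n m < D}"
    and z: "z \<in> vanishing n k" and gz: "hom_comp n D (\<Sum>m\<in>M. ?f m) = g + z"
    using lowv_subset_GS[OF assms(1,2), of D] by blast
  define L where "L = {mon m |m. mon m \<in> GS n k \<and> tdeg n m < D}"
  have L: "L \<subseteq> GS n k" "finite L" using fin finite_subset[of L "GS n k"] by (auto simp: L_def)
  obtain b where b: "g = (\<Sum>q\<in>L. scl (b q) q)"
    using g L(2) unfolding L_def[symmetric] poly_vs.span_finite[OF L(2)] by blast
  \<comment> \<open>The coefficients of that difference. Since \<open>mon m0\<close> has degree
    \<open>D\<close>, it is not in \<open>L\<close> and keeps its coefficient from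
    \<open>c\<close>.\<close>
  define e where "e q = (if q \<in> mon ` {m \<in> M. tdeg n m = D} then c q else 0) - (if q \<in> L then b q else 0)" for q
  have "(\<Sum>q\<in>GS n k. scl (e q) q) = (\<Sum>q\<in>GS n k. if q \<in> mon ` {m \<in> M. tdeg n m = D} then scl (c q) q else 0)
      - (\<Sum>q\<in>GS n k. if q \<in> L then scl (b q) q else 0)"
    unfolding sum_subtractf[symmetric] e_def
    by (intro sum.cong refl) (auto simp: poly_vs.scale_left_diff_distrib poly_vs.scale_zero_left)
  also have "(\<Sum>q\<in>GS n k. if q \<in> L then scl (b q) q else 0) = g"
    unfolding b using fin L(1) by (simp add: sum.If_cases Int_absorb1)
  also have "(\<Sum>q\<in>GS n k. if q \<in> mon ` {m \<in> M. tdeg n m = D} then scl (c q) q else 0)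
      = (\<Sum>m\<in>M. if tdeg n m = D then ?f m else 0)"
    unfolding GS sum.reindex[OF inj] o_def
    by (intro sum.cong refl) (auto simp: mon_eq_iff)
  also have "\<dots> = hom_comp n D (\<Sum>m\<in>M. ?f m)"
    unfolding hom_comp_sum by (intro sum.cong refl) (simp add: hom_comp_scl hom_comp_single)
  finally have "(\<Sum>q\<in>GS n k. scl (e q) q) = z" using gz by simp
  then have "e (mon m0) = 0"
    using GS_independent_on_surj_words[OF assms(1,2), of e "mon m0"] z m0 by (simp add: N_def M_def)
  moreover have "mon m0 \<notin> L"
    using m0 by (auto simp: L_def mon_eq_iff)
  ultimately have "c (mon m0) = 0"
    using m0 by (auto simp: e_def N_def)
  then show False using m0 by (simp add: N_def)
qed

text \<open>Straightening in every degree, with the span plus the ideal as target; multiples of the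
  generators lie in the ideal outright.\<close>

lemma GS_spans_mod_ideal:
  assumes "1 \<le> k" "k \<le> n" "p \<in> poly_carrier n"
  shows "\<exists>f\<in>poly_vs.span (GS n k). \<exists>g\<in>I_ideal n k. p = f + g"
proof -
  interpret P: cring "poly_ring n" by (rule cring_poly_ring)
  interpret I: ideal "I_ideal n k" "poly_ring n" by (rule ideal_I_ideal)
  have mult: "f * g \<in> I_ideal n k" if "f \<in> poly_carrier n" "g \<in> I_ideal n k" for f g
    using I.I_l_closed[OF that(2), of f] that by (simp add: poly_ring_simps carrier_poly_ring)
  have "poly_vs.subspace (I_ideal n k)"
    unfolding poly_vs.subspace_def
    using I.zero_closed I.a_closed mult[OF const_poly_in_carrier]
    by (auto simp: poly_ring_simps)
  then have U: "poly_vs.subspace {f + g |f g. f \<in> poly_vs.span (GS n k) \<and> g \<in> I_ideal n k}"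
    (is "poly_vs.subspace ?U")
    by (intro poly_vs.subspace_sums poly_vs.subspace_span)
  have I_U: "g \<in> ?U" if "g \<in> I_ideal n k" for g
    using that poly_vs.span_zero by force
  have gen: "X i ^ k \<in> I_ideal n k" "elem_sym n d \<in> I_ideal n k"
    if "i \<in> {1..n}" "d \<in> {n - k + 1..n}" for i d
  proof -
    have "{X i ^ k |i. i \<in> {1..n}} \<union> {elem_sym n d |d. d \<in> {n - k + 1..n}} \<subseteq> carrier (poly_ring n)"
      by (auto simp: carrier_poly_ring elem_sym_def
          intro!: power_in_poly_carrier sum_in_poly_carrier prod_in_poly_carrier X_in_carrier)
    then have "{X i ^ k |i. i \<in> {1..n}} \<union> {elem_sym n d |d. d \<in> {n - k + 1..n}} \<subseteq> I_ideal n k"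
      unfolding I_ideal_def by (rule P.genideal_self)
    then show "X i ^ k \<in> I_ideal n k" "elem_sym n d \<in> I_ideal n k" using that by blast+
  qed
  have mon_carr: "mon m \<in> poly_carrier n" if "m \<in> expos n" for m
    using that by (simp add: poly_carrier_def expos_def)
  have mon_U: "mon m \<in> ?U" if m: "m \<in> expos n" for m
  proof (rule straightening[OF assms(1,2) U _ _ _ m refl])
    fix m assume "mon m \<in> GS n k"
    then have "mon m \<in> poly_vs.span (GS n k)" by (rule poly_vs.span_base)
    then show "mon m \<in> ?U" using I.zero_closed by (force simp: poly_ring_simps)
  next
    fix m i assume "m \<in> expos n" "i \<in> {1..n}"
    \<comment> \<open>\<open>gen\<close> carries range premises for both \<open>i\<close> and
      \<open>d\<close>; \<open>n\<close> here, and \<open>1\<close> in the next case, is an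
      admissible value for the index absent from the goal.\<close>
    then show "mon m * X i ^ k \<in> ?U"
      using assms by (intro I_U mult mon_carr gen(1)[of _ n]) auto
  next
    fix m d assume "m \<in> expos n" "d \<in> {n - k + 1..n}"
    then show "mon m * elem_sym n d \<in> ?U"
      using assms by (intro I_U mult mon_carr gen(2)[of 1]) auto
  qed
  have "p \<in> ?U"
    using assms(3)
    by (induction p rule: carrier_induct)
      (use poly_vs.subspace_0[OF U] poly_vs.subspace_add[OF U] poly_vs.subspace_scale[OF U] mon_U in blast)+
  then show ?thesis by blast
qed

section \<open>Transfer to the quotient\<close>

lemma R_class_eq_iff:
  assumes "f \<in> poly_carrier n" "g \<in> poly_carrier n"
  shows "R_class n k f = R_class n k g \<longleftrightarrow> f - g \<in> I_ideal n k"
proof -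
  interpret P: cring "poly_ring n" by (rule cring_poly_ring)
  have "\<ominus>\<^bsub>poly_ring n\<^esub> g = - g"
  proof -
    have "- g \<in> poly_carrier n" using assms(2) by (simp add: poly_carrier_def)
    then show ?thesis
      using assms(2) by (intro P.minus_equality) (auto simp: poly_ring_simps carrier_poly_ring)
  qed
  then have "f \<ominus>\<^bsub>poly_ring n\<^esub> g = f - g"
    by (simp add: a_minus_def poly_ring_simps)
  then show ?thesis
    using P.quotient_eq_iff_same_a_r_cos[OF ideal_I_ideal, of f g k] assms
    by (simp add: R_class_def carrier_poly_ring)
qed

lemma R_class_in_carrier: "f \<in> poly_carrier n \<Longrightarrow> R_class n k f \<in> carrier (R_quot n k)"
  using ring_hom_closed[OF R_class_hom, of f n k] by (simp add: R_quot_sel carrier_poly_ring)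

lemma R_class_0: "R_class n k 0 = \<zero>\<^bsub>R_quot n k\<^esub>"
  using ring_hom_zero[OF R_class_hom, of n k] cring_poly_ring[of n]
    ideal.quotient_is_cring[OF ideal_I_ideal cring_poly_ring, of n k]
  by (simp add: R_quot_sel poly_ring_simps cring_def)

text \<open>Turns combinations of polynomials into combinations of classes. Membership in the
  carrier is proved along with it, since additivity of \<open>R_class n k\<close> is available only
  there.\<close>

lemma R_class_lincomb:
  assumes "finite A" "A \<subseteq> poly_carrier n"
  shows "(\<Sum>p\<in>A. scl (c p) p) \<in> poly_carrier n \<and>
    R_class n k (\<Sum>p\<in>A. scl (c p) p) = (\<Oplus>\<^bsub>R_quot n k\<^esub>p\<in>A. c p \<odot>\<^bsub>R_quot n k\<^esub> R_class n k p)"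
proof -
  interpret V: vectorspace class_ring "R_quot n k" by (rule vectorspace_R_quot)
  from assms show ?thesis
  proof (induction A rule: finite_induct)
    case empty
    then show ?case using subcringE(2)[OF subcring_poly_carrier[of n]] by (simp add: R_class_0)
  next
    case (insert p A)
    let ?s = "\<Sum>p\<in>A. scl (c p) p"
    have p: "p \<in> poly_carrier n" and s: "?s \<in> poly_carrier n"
      and IH: "R_class n k ?s = (\<Oplus>\<^bsub>R_quot n k\<^esub>p\<in>A. c p \<odot>\<^bsub>R_quot n k\<^esub> R_class n k p)"
      using insert by auto
    have cp: "scl (c p) p \<in> poly_carrier n"
      using subcringE(6)[OF subcring_poly_carrier[of n] const_poly_in_carrier p] by simp
    have closed: "c q \<odot>\<^bsub>R_quot n k\<^esub> R_class n k q \<in> carrier (R_quot n k)" if "q \<in> insert p A" for q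
      using insert.prems that by (intro V.smult_closed R_class_in_carrier) auto
    have smult: "R_class n k (scl (c p) p) = c p \<odot>\<^bsub>R_quot n k\<^esub> R_class n k p"
      using ring_hom_mult[OF R_class_hom, of "const_poly (c p)" n p k] p const_poly_in_carrier
      by (simp add: carrier_poly_ring poly_ring_simps R_quot_sel)
    have "R_class n k (scl (c p) p + ?s) = R_class n k (scl (c p) p) \<oplus>\<^bsub>R_quot n k\<^esub> R_class n k ?s"
      using ring_hom_add[OF R_class_hom, of "scl (c p) p" n ?s k] cp s
      by (simp add: carrier_poly_ring poly_ring_simps R_quot_sel)
    moreover have "scl (c p) p + ?s \<in> poly_carrier n"
      using subcringE(7)[OF subcring_poly_carrier[of n] cp s] by simp
    ultimately show ?case
      using insert.hyps closed by (simp add: smult IH V.finsum_insert Pi_def)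
  qed
qed

text \<open>Injectivity is asserted as well because a basis predicate on the image set cannot detect
  monomials with equal classes.\<close>

theorem theorem5p3:
  fixes n k :: nat
  assumes "1 \<le> k" and "k \<le> n"
  shows "inj_on (R_class n k) (GS n k) \<and>
    vectorspace.basis class_ring (R_quot n k) (R_class n k ` GS n k)"
proof -
  interpret V: vectorspace class_ring "R_quot n k" by (rule vectorspace_R_quot)
  have fin: "finite (GS n k)" by (rule card_GS_le[OF assms])
  have carr: "GS n k \<subseteq> poly_carrier n"
    using GS_subset[OF assms(2)] by (simp add: carrier_poly_ring)
  have inj: "inj_on (R_class n k) (GS n k)"
  proof (rule inj_onI, rule ccontr)
    fix p q assume p: "p \<in> GS n k" and q: "q \<in> GS n k" and "R_class n k p = R_class n k q" "p \<noteq> q"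
    then have mem: "p - q \<in> I_ideal n k" using carr by (subst (asm) R_class_eq_iff) auto
    \<comment> \<open>The coefficients of the relation \<open>p - q\<close>, to which independence
      modulo the ideal applies.\<close>
    define c :: "rpoly \<Rightarrow> rat" where "c r = (if r = p then 1 else 0) - (if r = q then 1 else 0)" for r
    have "(\<Sum>r\<in>GS n k. scl (c r) r) = (\<Sum>r\<in>GS n k. if r = p then r else 0) - (\<Sum>r\<in>GS n k. if r = q then r else 0)"
      unfolding sum_subtractf[symmetric] c_def
      by (intro sum.cong refl) (auto simp: poly_vs.scale_left_diff_distrib)
    also have "\<dots> = p - q" using fin p q by simp
    finally have "c p = 0"
      using GS_independent_mod_ideal[OF assms, of c p] mem p by simp
    then show False using \<open>p \<noteq> q\<close> by (simp add: c_def)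
  qed
  have im: "R_class n k ` GS n k \<subseteq> carrier (R_quot n k)"
    using R_class_in_carrier carr by blast
  \<comment> \<open>By injectivity a combination of the classes is the class of a combination of the
    monomials, which reduces independence and spanning to polynomials.\<close>
  have lincomb: "V.lincomb a (R_class n k ` GS n k) = R_class n k (\<Sum>p\<in>GS n k. scl (a (R_class n k p)) p)" for a
  proof -
    have "V.lincomb a (R_class n k ` GS n k)
        = (\<Oplus>\<^bsub>R_quot n k\<^esub>p\<in>GS n k. a (R_class n k p) \<odot>\<^bsub>R_quot n k\<^esub> R_class n k p)"
      unfolding V.lincomb_def using inj im
      by (intro V.finsum_reindex) (auto intro!: V.smult_closed)
    then show ?thesis using R_class_lincomb[OF fin carr] by simp
  qed
  have "V.lin_indpt (R_class n k ` GS n k)"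
  proof (rule V.finite_lin_indpt2)
    fix a assume "V.lincomb a (R_class n k ` GS n k) = \<zero>\<^bsub>R_quot n k\<^esub>"
    then have "R_class n k (\<Sum>p\<in>GS n k. scl (a (R_class n k p)) p) = R_class n k 0"
      by (simp add: lincomb R_class_0)
    then have "(\<Sum>p\<in>GS n k. scl (a (R_class n k p)) p) \<in> I_ideal n k"
      using R_class_lincomb[OF fin carr, of "\<lambda>p. a (R_class n k p)"] subcringE(2)[OF subcring_poly_carrier[of n]]
      by (subst (asm) R_class_eq_iff) auto
    then have "a (R_class n k p) = 0" if "p \<in> GS n k" for p
      by (rule GS_independent_mod_ideal[OF assms _ that])
    then show "\<forall>v\<in>R_class n k ` GS n k. a v = \<zero>\<^bsub>class_ring\<^esub>" by simp
  qed (use fin im in auto)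
  moreover have "V.span (R_class n k ` GS n k) = carrier (R_quot n k)"
  proof
    show "V.span (R_class n k ` GS n k) \<subseteq> carrier (R_quot n k)"
      using im by (rule V.span_is_subset2)
    show "carrier (R_quot n k) \<subseteq> V.span (R_class n k ` GS n k)"
    proof
      fix U assume "U \<in> carrier (R_quot n k)"
      then obtain p where p: "p \<in> poly_carrier n" "U = R_class n k p"
        by (auto simp: R_quot_sel FactRing_def A_RCOSETS_def' R_class_def carrier_poly_ring)
      obtain f g where f: "f \<in> poly_vs.span (GS n k)" and g: "g \<in> I_ideal n k" and "p = f + g"
        using GS_spans_mod_ideal[OF assms p(1)] by blast
      obtain c where c: "f = (\<Sum>q\<in>GS n k. scl (c q) q)"
        using f unfolding poly_vs.span_finite[OF fin] by blast
      have "f \<in> poly_carrier n" unfolding c using R_class_lincomb[OF fin carr] by blast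
      then have "U = R_class n k f"
        unfolding p(2) using p(1) g \<open>p = f + g\<close> by (subst R_class_eq_iff) auto
      also have "\<dots> = V.lincomb (\<lambda>v. c (inv_into (GS n k) (R_class n k) v)) (R_class n k ` GS n k)"
        unfolding lincomb c
        by (intro arg_cong[of _ _ "R_class n k"] sum.cong refl) (simp add: inv_into_f_f[OF inj])
      also have "\<dots> \<in> V.span (R_class n k ` GS n k)"
        unfolding V.span_def by (intro CollectI exI conjI refl) (use fin in auto)
      finally show "U \<in> V.span (R_class n k ` GS n k)" .
    qed
  qed
  ultimately show ?thesis
    unfolding V.basis_def using inj im by blast
qed

end
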